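(* Let $F$ be the cdf of the finite mixed skew-$t$ distribution with $r$ components (parameters $0<v_1<\dots<v_r$, $\beta_i\in\mathbb{R}$, $p_i>0$, $\sum_i p_i=1$), and let $\kappa$, $a_n$, $\Phi_v$, $A_1,\dots,A_5$ and the indicator notation $\mathbf 1\{\cdot\}$ be as in the context. Then for $x>0$, as $n\to\infty$, the following hold. (i) If $0<v_1<2$ and $v_2>2v_1$, set $\gamma_1=\min\{2,v_2-v_1,2v_1\}-v_1$. Then $$a_n^{\gamma_1}\Big[a_n^{v_1}(F^n(a_nx)-\Phi_{v_1}(x))-k_1(x)\Phi_{v_1}(x)\Big]\to\omega_1(x)\Phi_{v_1}(x),$$ where $k_1(x)=-\kappa x^{-2v_1}$ and $$\omega_1(x)=-\Big(\mathbf 1\{0<v_1<1,\,2v_1<v_2\le 3v_1\}+\mathbf 1\{1\le v_1<2,\,2v_1<v_2\le v_1+2\}\Big)A_3x^{-v_2}$$ $$-\mathbf 1\{0<v_1\le 1,\,v_2\ge 3v_1\}\Big(\tfrac43\kappa^2x^{-3v_1}-\tfrac{k_1^2(x)}{2}\Big)-\mathbf 1\{1\le v_1<2,\,v_2\ge v_1+2\}A_1x^{-v_1-2}.$$ (ii) If $v_1>2$ and $v_2>v_1+2$, set $\gamma_2=\min\{4,v_2-v_1,v_1\}-2$. Then $$a_n^{\gamma_2}\Big[a_n^{2}(F^n(a_nx)-\Phi_{v_1}(x))-k_2(x)\Phi_{v_1}(x)\Big]\to\omega_2(x)\Phi_{v_1}(x),$$ where $k_2(x)=-A_1x^{-v_1-2}$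 and $$\omega_2(x)=-\mathbf 1\{v_1\ge4,\,v_2\ge v_1+4\}\Big(A_2x^{-v_1-4}-\tfrac{k_2^2(x)}{2}\Big)$$ $$-\Big(\mathbf 1\{2<v_1<4,\,v_1+2<v_2\le2v_1\}+\mathbf 1\{v_1\ge4,\,v_1+2<v_2\le v_1+4\}\Big)A_3x^{-v_2}-\mathbf 1\{2<v_1\le4,\,v_2\ge2v_1\}\,\kappa x^{-2v_1}.$$ (iii) If $0<v_1<v_2<\min\{2v_1,v_1+2\}$, set $\gamma_3=\min\{2,v_1,2(v_2-v_1),v_3-v_1\}-v_2+v_1$. Then $$a_n^{\gamma_3}\Big[a_n^{v_2-v_1}(F^n(a_nx)-\Phi_{v_1}(x))-k_3(x)\Phi_{v_1}(x)\Big]\to\omega_3(x)\Phi_{v_1}(x),$$ where $k_3(x)=-A_3x^{-v_2}$ and $$\omega_3(x)=-\mathbf 1\{v_1\ge2,\,v_1+1\le v_2<v_1+2,\,v_3\ge v_1+2\}A_1x^{-v_1-2}-\mathbf 1\{0<v_1\le2,\,\tfrac32v_1\le v_2<2v_1,\,v_3\ge2v_1\}\,\kappa x^{-2v_1}$$ $$-\Big(\mathbf 1\{0<v_1<2,\,\tfrac{v_1+v_3}{2}\le v_2<2v_1,\,v_2<v_3\le2v_1\}+\mathbf 1\{v_1\ge2,\,\tfrac{v_1+v_3}{2}\le v_2<v_1+2,\,v_2<v_3\le2+v_1\}\Big)A_5x^{-v_3}$$ $$+\Big(\mathbf 1\{v_1\ge2,\,v_1<v_2\le1+v_1,\,v_3\ge2+v_1\}+\mathbf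 1\{v_1>2,\,v_1<v_2\le\tfrac{v_1+v_3}{2},\,v_2<v_3\le2+v_1\}$$ $$+\mathbf 1\{0<v_1<2,\,v_1<v_2\le\tfrac{3v_1}{2},\,v_3\ge2v_1\}+\mathbf 1\{0<v_1<2,\,v_1<v_2\le\tfrac{v_1+v_3}{2},\,v_3<2v_1\}\Big)\frac{A_3^2x^{-2v_2}}{2}.$$ (iv) If $v_1=2$ and $v_2>4$, set $\gamma_4=\min\{v_2-2,4\}-2$. Then $$a_n^{\gamma_4}\Big[a_n^2(F^n(a_nx)-\Phi_2(x))-k_4(x)\Phi_2(x)\Big]\to\omega_4(x)\Phi_2(x),$$ where $k_4(x)=-A_1x^{-4}-\frac12p_1T_3(\sqrt3\beta_1)x^{-4}$ and $$\omega_4(x)=-\mathbf 1\{4<v_2\le6\}A_3x^{-v_2}-\mathbf 1\{v_2\ge6\}\Big(A_2x^{-6}+p_1A_1T_3(\sqrt3\beta_1)x^{-6}+\tfrac13p_1^2T_3^2(\sqrt3\beta_1)x^{-6}-\tfrac{k_4^2(x)}{2}\Big).$$ (v) If $v_1>2$ and $v_2=v_1+2$, set $\gamma_5=\min\{v_1,4,v_3-v_1\}-2$. Then $$a_n^{\gamma_5}\Big[a_n^2(F^n(a_nx)-\Phi_{v_1}(x))-k_5(x)\Phi_{v_1}(x)\Big]\to\omega_5(x)\Phi_{v_1}(x),$$ where $k_5(x)=-A_1x^{-v_1-2}-A_3x^{-v_2}$ and $$\omega_5(x)=-\mathbf 1\{2<v_1\le4,\,v_3\ge2v_1\}\,\kappa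 x^{-2v_1}-\mathbf 1\{v_1\ge4,\,v_3\ge v_1+4\}\Big(A_2x^{-v_1-4}+A_4x^{-v_1-4}-\tfrac{k_5^2(x)}{2}\Big)$$ $$-\Big(\mathbf 1\{2<v_1<4,\,v_1+2<v_3\le2v_1\}+\mathbf 1\{v_1\ge4,\,v_1+2<v_3\le v_1+4\}\Big)A_5x^{-v_3}.$$ (vi) If $0<v_1<2$ and $v_2=2v_1$, set $\gamma_6=\min\{2,2v_1,v_3-v_1\}-v_1$. Then $$a_n^{\gamma_6}\Big[a_n^{v_1}(F^n(a_nx)-\Phi_{v_1}(x))-k_6(x)\Phi_{v_1}(x)\Big]\to\omega_6(x)\Phi_{v_1}(x),$$ where $k_6(x)=-A_3x^{-2v_1}-\kappa x^{-2v_1}$ and $$\omega_6(x)=-\mathbf 1\{1\le v_1<2,\,v_3\ge v_1+2\}A_1x^{-v_1-2}-\mathbf 1\{0<v_1\le1,\,v_3\ge3v_1\}\Big(2A_3\kappa x^{-v_2-v_1}+\tfrac43\kappa^2x^{-3v_1}-\tfrac{k_6^2(x)}{2}\Big)$$ $$-\Big(\mathbf 1\{0<v_1<1,\,2v_1<v_3\le3v_1\}+\mathbf 1\{1\le v_1<2,\,2v_1<v_3\le v_1+2\}\Big)A_5x^{-v_3}.$$ (vii) If $v_1=2$ and $v_2=4$, set $\gamma_7=\min\{v_3-2,4\}-2$. Then $$a_n^{\gamma_7}\Big[a_n^2(F^n(a_nx)-\Phi_2(x))-k_7(x)\Phi_2(x)\Big]\to\omega_7(x)\Phi_2(x),$$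 where $k_7(x)=-A_1x^{-4}-A_3x^{-4}-\frac12p_1T_3(\sqrt3\beta_1)x^{-4}$ and $$\omega_7(x)=-\mathbf 1\{4<v_3\le6\}A_5x^{-v_3}-\mathbf 1\{v_3\ge6\}\Big(A_2x^{-6}+A_3p_1T_3(\sqrt3\beta_1)x^{-6}+p_1A_1T_3(\sqrt3\beta_1)x^{-6}+\tfrac13p_1^2T_3^2(\sqrt3\beta_1)x^{-6}+A_4x^{-6}-\tfrac{k_7^2(x)}{2}\Big).$$
   Context: Student $t$: for $v>0$, $t_v(x)=C_v(1+x^2/v)^{-(v+1)/2}$ with $C_v=\frac{\Gamma((v+1)/2)}{\Gamma(v/2)\sqrt{v\pi}}$ is the pdf, and $T_v$ is the cdf, of the standard Student $t$ distribution with $v$ degrees of freedom. Skew-$t$: $\mathrm{ST}_v(\beta)$ ($v>0$, $\beta\in\mathbb{R}$) is the distribution on $\mathbb{R}$ with pdf $2t_v(x)T_{v+1}\big(\beta x\sqrt{\tfrac{v+1}{x^2+v}}\big)$; its cdf is denoted $F_{v,\beta}$. Mixed skew-$t$ distribution (MSTD) with $r$ components: given $0<v_1<v_2<\dots<v_r$, $\beta_i\in\mathbb{R}$, $p_i>0$ with $\sum_{i=1}^rp_i=1$, it is the distribution with cdf $F(x)=\sum_{i=1}^rp_iF_{v_i,\beta_i}(x)$. $\Phi_v(x)=\exp(-x^{-v})$ for $x>0$. $\mathbf 1\{\cdot\}$ equals $1$ if all listed conditions hold and $0$ otherwise. Abbreviation and norming constant: $$\kappa=p_1C_{v_1}v_1^{\frac{v_1-1}{2}}T_{v_1+1}(\beta_1\sqrt{v_1+1}),\qquad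 a_n=\big(2p_1C_{v_1}T_{v_1+1}(\beta_1\sqrt{v_1+1})\big)^{1/v_1}v_1^{\frac{v_1-1}{2v_1}}n^{1/v_1}\quad(\text{so } a_n^{v_1}=2\kappa n).$$ Constants: $$A_1=-\frac{C_{v_1+1}v_1^2\sqrt{v_1+1}\,\beta_1(1+\beta_1^2)^{-\frac{v_1+2}{2}}}{2T_{v_1+1}(\beta_1\sqrt{v_1+1})(v_1+2)}-\frac{v_1^2(v_1+1)}{2(v_1+2)},$$ $$A_2=\frac{C_{v_1+1}\sqrt{v_1+1}\,\beta_1(1+\beta_1^2)^{-\frac{v_1+2}{2}}}{T_{v_1+1}(\beta_1\sqrt{v_1+1})}\left[\frac{v_1^3(v_1-1)}{4(v_1+2)}+\frac{3v_1^2}{8}-\frac{3v_1^2}{(v_1+2)(v_1+4)}-\frac{(v_1+2)\beta_1^2v_1^3}{8(v_1+4)(1+\beta_1^2)}\right]$$ $$\qquad+\frac{v_1^2(v_1^2-1)}{8}+\frac{3v_1^2}{(v_1+2)(v_1+4)}+\frac{v_1^2(v_1-1)}{2(v_1+2)},$$ $$A_3=\frac{p_2C_{v_2}v_2^{\frac{v_2-1}{2}}T_{v_2+1}(\beta_2\sqrt{v_2+1})}{p_1C_{v_1}v_1^{\frac{v_1-1}{2}}T_{v_1+1}(\beta_1\sqrt{v_1+1})},$$ $$A_4=-A_3\left(\frac{C_{v_2+1}v_2^2\sqrt{v_2+1}\,\beta_2(1+\beta_2^2)^{-\frac{v_2+2}{2}}}{2(v_2+2)T_{v_2+1}(\beta_2\sqrt{v_2+1})}+\frac{v_2^2(v_2+1)}{2(v_2+2)}\right),$$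 $$A_5=\frac{p_3C_{v_3}v_3^{\frac{v_3-1}{2}}T_{v_3+1}(\beta_3\sqrt{v_3+1})}{p_1C_{v_1}v_1^{\frac{v_1-1}{2}}T_{v_1+1}(\beta_1\sqrt{v_1+1})}.$$
   Formalization: In ω₃ of (iii), the second indicator multiplying A₃²x^{-2v₂}/2 is corrected to 1{v₁≥2, v₁<v₂≤(v₁+v₃)/2, v₂<v₃<2+v₁}; as printed the limit is wrong, e.g. doubled at v=(3,3.5,5) and missing at v=(2,2.5,3.5). *)

theory Defs
  imports "HOL-Probability.Probability"
begin

definition student_const :: "real \<Rightarrow> real" where
  "student_const v = Gamma ((v + 1) / 2) / (Gamma (v / 2) * sqrt (v * pi))"

definition student_pdf :: "real \<Rightarrow> real \<Rightarrow> real" where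
  "student_pdf v x = student_const v * (1 + x\<^sup>2 / v) powr (- ((v + 1) / 2))"

definition student_cdf :: "real \<Rightarrow> real \<Rightarrow> real" where
  "student_cdf v = cdf (density lborel (\<lambda>x. ennreal (student_pdf v x)))"

definition skew_t_pdf :: "real \<Rightarrow> real \<Rightarrow> real \<Rightarrow> real" where
  "skew_t_pdf v b x =
     2 * student_pdf v x * student_cdf (v + 1) (b * x * sqrt ((v + 1) / (x\<^sup>2 + v)))"

definition skew_t_cdf :: "real \<Rightarrow> real \<Rightarrow> real \<Rightarrow> real" where
  "skew_t_cdf v b = cdf (density lborel (\<lambda>x. ennreal (skew_t_pdf v b x)))"

definition mstd_cdf ::
  "nat \<Rightarrow> (nat \<Rightarrow> real) \<Rightarrow> (nat \<Rightarrow> real) \<Rightarrow> (nat \<Rightarrow> real) \<Rightarrow> real \<Rightarrow> real" where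
  "mstd_cdf r v \<beta> p x = (\<Sum>i = 1..r. p i * skew_t_cdf (v i) (\<beta> i) x)"

definition Frechet :: "real \<Rightarrow> real \<Rightarrow> real" where
  "Frechet v x = exp (- (x powr (- v)))"

definition kappa :: "(nat \<Rightarrow> real) \<Rightarrow> (nat \<Rightarrow> real) \<Rightarrow> (nat \<Rightarrow> real) \<Rightarrow> real" where
  "kappa v \<beta> p = p 1 * student_const (v 1) * v 1 powr ((v 1 - 1) / 2)
     * student_cdf (v 1 + 1) (\<beta> 1 * sqrt (v 1 + 1))"

definition norming ::
  "(nat \<Rightarrow> real) \<Rightarrow> (nat \<Rightarrow> real) \<Rightarrow> (nat \<Rightarrow> real) \<Rightarrow> nat \<Rightarrow> real" where
  "norming v \<beta> p n =
     (2 * p 1 * student_const (v 1) * student_cdf (v 1 + 1) (\<beta> 1 * sqrt (v 1 + 1))) powr (1 / v 1)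
     * v 1 powr ((v 1 - 1) / (2 * v 1)) * real n powr (1 / v 1)"

definition A1 :: "(nat \<Rightarrow> real) \<Rightarrow> (nat \<Rightarrow> real) \<Rightarrow> real" where
  "A1 v \<beta> =
     - (student_const (v 1 + 1) * (v 1)\<^sup>2 * sqrt (v 1 + 1) * \<beta> 1
          * (1 + (\<beta> 1)\<^sup>2) powr (- ((v 1 + 2) / 2)))
        / (2 * student_cdf (v 1 + 1) (\<beta> 1 * sqrt (v 1 + 1)) * (v 1 + 2))
     - (v 1)\<^sup>2 * (v 1 + 1) / (2 * (v 1 + 2))"

definition A2 :: "(nat \<Rightarrow> real) \<Rightarrow> (nat \<Rightarrow> real) \<Rightarrow> real" where
  "A2 v \<beta> =
     student_const (v 1 + 1) * sqrt (v 1 + 1) * \<beta> 1 * (1 + (\<beta> 1)\<^sup>2) powr (- ((v 1 + 2) / 2))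
        / student_cdf (v 1 + 1) (\<beta> 1 * sqrt (v 1 + 1))
      * ((v 1) ^ 3 * (v 1 - 1) / (4 * (v 1 + 2)) + 3 * (v 1)\<^sup>2 / 8
         - 3 * (v 1)\<^sup>2 / ((v 1 + 2) * (v 1 + 4))
         - (v 1 + 2) * (\<beta> 1)\<^sup>2 * (v 1) ^ 3 / (8 * (v 1 + 4) * (1 + (\<beta> 1)\<^sup>2)))
     + (v 1)\<^sup>2 * ((v 1)\<^sup>2 - 1) / 8 + 3 * (v 1)\<^sup>2 / ((v 1 + 2) * (v 1 + 4))
     + (v 1)\<^sup>2 * (v 1 - 1) / (2 * (v 1 + 2))"

definition A3 :: "(nat \<Rightarrow> real) \<Rightarrow> (nat \<Rightarrow> real) \<Rightarrow> (nat \<Rightarrow> real) \<Rightarrow> real" where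
  "A3 v \<beta> p =
     (p 2 * student_const (v 2) * v 2 powr ((v 2 - 1) / 2)
        * student_cdf (v 2 + 1) (\<beta> 2 * sqrt (v 2 + 1)))
     / (p 1 * student_const (v 1) * v 1 powr ((v 1 - 1) / 2)
        * student_cdf (v 1 + 1) (\<beta> 1 * sqrt (v 1 + 1)))"

definition A4 :: "(nat \<Rightarrow> real) \<Rightarrow> (nat \<Rightarrow> real) \<Rightarrow> (nat \<Rightarrow> real) \<Rightarrow> real" where
  "A4 v \<beta> p =
     - A3 v \<beta> p *
      (student_const (v 2 + 1) * (v 2)\<^sup>2 * sqrt (v 2 + 1) * \<beta> 2
          * (1 + (\<beta> 2)\<^sup>2) powr (- ((v 2 + 2) / 2))
        / (2 * (v 2 + 2) * student_cdf (v 2 + 1) (\<beta> 2 * sqrt (v 2 + 1)))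
       + (v 2)\<^sup>2 * (v 2 + 1) / (2 * (v 2 + 2)))"

definition A5 :: "(nat \<Rightarrow> real) \<Rightarrow> (nat \<Rightarrow> real) \<Rightarrow> (nat \<Rightarrow> real) \<Rightarrow> real" where
  "A5 v \<beta> p =
     (p 3 * student_const (v 3) * v 3 powr ((v 3 - 1) / 2)
        * student_cdf (v 3 + 1) (\<beta> 3 * sqrt (v 3 + 1)))
     / (p 1 * student_const (v 1) * v 1 powr ((v 1 - 1) / 2)
        * student_cdf (v 1 + 1) (\<beta> 1 * sqrt (v 1 + 1)))"

text \<open>
  The degrees of freedom as they occur in case distinctions and minima. The result mentions
  the second and third component for a mixture with an arbitrary number \<open>r\<close> of components;
  an absent component counts as having infinitely many degrees of freedom. Thus conditions
  bounding it from below hold, those bounding it from above fail, and it does not contribute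
  to a minimum. For \<open>r \<ge> 3\<close> this is just \<open>v\<close>.
\<close>
definition dof :: "nat \<Rightarrow> (nat \<Rightarrow> real) \<Rightarrow> nat \<Rightarrow> ereal" where
  "dof r v i = (if i \<le> r then ereal (v i) else \<infinity>)"

definition gamma1 :: "nat \<Rightarrow> (nat \<Rightarrow> real) \<Rightarrow> real" where
  "gamma1 r v = real_of_ereal (Min {2, dof r v 2 - v 1, 2 * v 1}) - v 1"

definition gamma2 :: "nat \<Rightarrow> (nat \<Rightarrow> real) \<Rightarrow> real" where
  "gamma2 r v = real_of_ereal (Min {4, dof r v 2 - v 1, v 1}) - 2"

definition gamma3 :: "nat \<Rightarrow> (nat \<Rightarrow> real) \<Rightarrow> real" where
  "gamma3 r v =
     real_of_ereal (Min {2, ereal (v 1), 2 * (dof r v 2 - v 1), dof r v 3 - v 1}) - v 2 + v 1"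

definition gamma4 :: "nat \<Rightarrow> (nat \<Rightarrow> real) \<Rightarrow> real" where
  "gamma4 r v = real_of_ereal (Min {dof r v 2 - 2, 4}) - 2"

definition gamma5 :: "nat \<Rightarrow> (nat \<Rightarrow> real) \<Rightarrow> real" where
  "gamma5 r v = real_of_ereal (Min {ereal (v 1), 4, dof r v 3 - v 1}) - 2"

definition gamma6 :: "nat \<Rightarrow> (nat \<Rightarrow> real) \<Rightarrow> real" where
  "gamma6 r v = real_of_ereal (Min {2, 2 * v 1, dof r v 3 - v 1}) - v 1"

definition gamma7 :: "nat \<Rightarrow> (nat \<Rightarrow> real) \<Rightarrow> real" where
  "gamma7 r v = real_of_ereal (Min {dof r v 3 - 2, 4}) - 2"

definition k1 :: "(nat \<Rightarrow> real) \<Rightarrow> (nat \<Rightarrow> real) \<Rightarrow> (nat \<Rightarrow> real) \<Rightarrow> real \<Rightarrow> real" where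
  "k1 v \<beta> p x =
     - kappa v \<beta> p * x powr (- 2 * v 1)"

definition omega1 :: "nat \<Rightarrow> (nat \<Rightarrow> real) \<Rightarrow> (nat \<Rightarrow> real) \<Rightarrow> (nat \<Rightarrow> real) \<Rightarrow> real \<Rightarrow> real" where
  "omega1 r v \<beta> p x =
     - (of_bool (0 < v 1 \<and> v 1 < 1 \<and> 2 * v 1 < dof r v 2 \<and> dof r v 2 \<le> 3 * v 1)
        + of_bool (1 \<le> v 1 \<and> v 1 < 2 \<and> 2 * v 1 < dof r v 2 \<and> dof r v 2 \<le> v 1 + 2))
        * A3 v \<beta> p * x powr (- v 2)
     - of_bool (0 < v 1 \<and> v 1 \<le> 1 \<and> dof r v 2 \<ge> 3 * v 1)
        * (4 / 3 * (kappa v \<beta> p)\<^sup>2 * x powr (- 3 * v 1) - (k1 v \<beta> p x)\<^sup>2 / 2)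
     - of_bool (1 \<le> v 1 \<and> v 1 < 2 \<and> dof r v 2 \<ge> v 1 + 2)
        * A1 v \<beta> * x powr (- v 1 - 2)"

definition k2 :: "(nat \<Rightarrow> real) \<Rightarrow> (nat \<Rightarrow> real) \<Rightarrow> (nat \<Rightarrow> real) \<Rightarrow> real \<Rightarrow> real" where
  "k2 v \<beta> p x =
     - A1 v \<beta> * x powr (- v 1 - 2)"

definition omega2 :: "nat \<Rightarrow> (nat \<Rightarrow> real) \<Rightarrow> (nat \<Rightarrow> real) \<Rightarrow> (nat \<Rightarrow> real) \<Rightarrow> real \<Rightarrow> real" where
  "omega2 r v \<beta> p x =
     - of_bool (v 1 \<ge> 4 \<and> dof r v 2 \<ge> v 1 + 4)
        * (A2 v \<beta> * x powr (- v 1 - 4) - (k2 v \<beta> p x)\<^sup>2 / 2)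
     - (of_bool (2 < v 1 \<and> v 1 < 4 \<and> v 1 + 2 < dof r v 2 \<and> dof r v 2 \<le> 2 * v 1)
        + of_bool (v 1 \<ge> 4 \<and> v 1 + 2 < dof r v 2 \<and> dof r v 2 \<le> v 1 + 4))
        * A3 v \<beta> p * x powr (- v 2)
     - of_bool (2 < v 1 \<and> v 1 \<le> 4 \<and> dof r v 2 \<ge> 2 * v 1)
        * kappa v \<beta> p * x powr (- 2 * v 1)"

definition k3 :: "(nat \<Rightarrow> real) \<Rightarrow> (nat \<Rightarrow> real) \<Rightarrow> (nat \<Rightarrow> real) \<Rightarrow> real \<Rightarrow> real" where
  "k3 v \<beta> p x =
     - A3 v \<beta> p * x powr (- v 2)"

text \<open>
  The four conditions on the square of \<open>A3\<close> are meant to be the disjoint cases in which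
  \<open>2 * (v 2 - v 1)\<close> attains the minimum in \<open>gamma3\<close>. The second of them is printed in
  the source with \<open>v 1 > 2\<close> and \<open>v 3 \<le> 2 + v 1\<close>. Then for \<open>v 3 = 2 + v 1\<close>,
  \<open>v 1 > 2\<close>, \<open>v 2 \<le> 1 + v 1\<close> it overlaps with the first one, so that the term is counted
  twice, and for \<open>v 1 = 2\<close>, \<open>v 3 < 4\<close> the term is missing; in both situations the
  asserted limit would be wrong. Here the equality sign is put where it belongs:
  \<open>v 1 \<ge> 2\<close> and \<open>v 3 < 2 + v 1\<close>. All other parameters give the same value.
\<close>
definition omega3 :: "nat \<Rightarrow> (nat \<Rightarrow> real) \<Rightarrow> (nat \<Rightarrow> real) \<Rightarrow> (nat \<Rightarrow> real) \<Rightarrow> real \<Rightarrow> real" where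
  "omega3 r v \<beta> p x =
     - of_bool (v 1 \<ge> 2 \<and> v 1 + 1 \<le> dof r v 2 \<and> dof r v 2 < v 1 + 2 \<and> dof r v 3 \<ge> v 1 + 2)
        * A1 v \<beta> * x powr (- v 1 - 2)
     - of_bool (0 < v 1 \<and> v 1 \<le> 2 \<and> 3 / 2 * v 1 \<le> dof r v 2 \<and> dof r v 2 < 2 * v 1 \<and> dof r v 3 \<ge> 2 * v 1)
        * kappa v \<beta> p * x powr (- 2 * v 1)
     - (of_bool (0 < v 1 \<and> v 1 < 2 \<and> (v 1 + dof r v 3) / 2 \<le> dof r v 2 \<and> dof r v 2 < 2 * v 1
            \<and> dof r v 2 < dof r v 3 \<and> dof r v 3 \<le> 2 * v 1)
        + of_bool (v 1 \<ge> 2 \<and> (v 1 + dof r v 3) / 2 \<le> dof r v 2 \<and> dof r v 2 < v 1 + 2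
            \<and> dof r v 2 < dof r v 3 \<and> dof r v 3 \<le> 2 + v 1))
        * A5 v \<beta> p * x powr (- v 3)
     + (of_bool (v 1 \<ge> 2 \<and> v 1 < dof r v 2 \<and> dof r v 2 \<le> 1 + v 1 \<and> dof r v 3 \<ge> 2 + v 1)
        + of_bool (v 1 \<ge> 2 \<and> v 1 < dof r v 2 \<and> dof r v 2 \<le> (v 1 + dof r v 3) / 2
            \<and> dof r v 2 < dof r v 3 \<and> dof r v 3 < 2 + v 1)
        + of_bool (0 < v 1 \<and> v 1 < 2 \<and> v 1 < dof r v 2 \<and> dof r v 2 \<le> 3 * v 1 / 2 \<and> dof r v 3 \<ge> 2 * v 1)
        + of_bool (0 < v 1 \<and> v 1 < 2 \<and> v 1 < dof r v 2 \<and> dof r v 2 \<le> (v 1 + dof r v 3) / 2 \<and> dof r v 3 < 2 * v 1))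
        * (A3 v \<beta> p)\<^sup>2 * x powr (- 2 * v 2) / 2"

definition k4 :: "(nat \<Rightarrow> real) \<Rightarrow> (nat \<Rightarrow> real) \<Rightarrow> (nat \<Rightarrow> real) \<Rightarrow> real \<Rightarrow> real" where
  "k4 v \<beta> p x =
     - A1 v \<beta> * x powr (- 4) - 1 / 2 * p 1 * student_cdf 3 (sqrt 3 * \<beta> 1) * x powr (- 4)"

definition omega4 :: "nat \<Rightarrow> (nat \<Rightarrow> real) \<Rightarrow> (nat \<Rightarrow> real) \<Rightarrow> (nat \<Rightarrow> real) \<Rightarrow> real \<Rightarrow> real" where
  "omega4 r v \<beta> p x =
     - of_bool (4 < dof r v 2 \<and> dof r v 2 \<le> 6) * A3 v \<beta> p * x powr (- v 2)
     - of_bool (dof r v 2 \<ge> 6)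
        * (A2 v \<beta> * x powr (- 6) + p 1 * A1 v \<beta> * student_cdf 3 (sqrt 3 * \<beta> 1) * x powr (- 6)
           + 1 / 3 * (p 1)\<^sup>2 * (student_cdf 3 (sqrt 3 * \<beta> 1))\<^sup>2 * x powr (- 6)
           - (k4 v \<beta> p x)\<^sup>2 / 2)"

definition k5 :: "(nat \<Rightarrow> real) \<Rightarrow> (nat \<Rightarrow> real) \<Rightarrow> (nat \<Rightarrow> real) \<Rightarrow> real \<Rightarrow> real" where
  "k5 v \<beta> p x =
     - A1 v \<beta> * x powr (- v 1 - 2) - A3 v \<beta> p * x powr (- v 2)"

definition omega5 :: "nat \<Rightarrow> (nat \<Rightarrow> real) \<Rightarrow> (nat \<Rightarrow> real) \<Rightarrow> (nat \<Rightarrow> real) \<Rightarrow> real \<Rightarrow> real" where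
  "omega5 r v \<beta> p x =
     - of_bool (2 < v 1 \<and> v 1 \<le> 4 \<and> dof r v 3 \<ge> 2 * v 1)
        * kappa v \<beta> p * x powr (- 2 * v 1)
     - of_bool (v 1 \<ge> 4 \<and> dof r v 3 \<ge> v 1 + 4)
        * (A2 v \<beta> * x powr (- v 1 - 4) + A4 v \<beta> p * x powr (- v 1 - 4)
           - (k5 v \<beta> p x)\<^sup>2 / 2)
     - (of_bool (2 < v 1 \<and> v 1 < 4 \<and> v 1 + 2 < dof r v 3 \<and> dof r v 3 \<le> 2 * v 1)
        + of_bool (v 1 \<ge> 4 \<and> v 1 + 2 < dof r v 3 \<and> dof r v 3 \<le> v 1 + 4))
        * A5 v \<beta> p * x powr (- v 3)"

definition k6 :: "(nat \<Rightarrow> real) \<Rightarrow> (nat \<Rightarrow> real) \<Rightarrow> (nat \<Rightarrow> real) \<Rightarrow> real \<Rightarrow> real" where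
  "k6 v \<beta> p x =
     - A3 v \<beta> p * x powr (- 2 * v 1) - kappa v \<beta> p * x powr (- 2 * v 1)"

definition omega6 :: "nat \<Rightarrow> (nat \<Rightarrow> real) \<Rightarrow> (nat \<Rightarrow> real) \<Rightarrow> (nat \<Rightarrow> real) \<Rightarrow> real \<Rightarrow> real" where
  "omega6 r v \<beta> p x =
     - of_bool (1 \<le> v 1 \<and> v 1 < 2 \<and> dof r v 3 \<ge> v 1 + 2)
        * A1 v \<beta> * x powr (- v 1 - 2)
     - of_bool (0 < v 1 \<and> v 1 \<le> 1 \<and> dof r v 3 \<ge> 3 * v 1)
        * (2 * A3 v \<beta> p * kappa v \<beta> p * x powr (- v 2 - v 1)
           + 4 / 3 * (kappa v \<beta> p)\<^sup>2 * x powr (- 3 * v 1) - (k6 v \<beta> p x)\<^sup>2 / 2)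
     - (of_bool (0 < v 1 \<and> v 1 < 1 \<and> 2 * v 1 < dof r v 3 \<and> dof r v 3 \<le> 3 * v 1)
        + of_bool (1 \<le> v 1 \<and> v 1 < 2 \<and> 2 * v 1 < dof r v 3 \<and> dof r v 3 \<le> v 1 + 2))
        * A5 v \<beta> p * x powr (- v 3)"

definition k7 :: "(nat \<Rightarrow> real) \<Rightarrow> (nat \<Rightarrow> real) \<Rightarrow> (nat \<Rightarrow> real) \<Rightarrow> real \<Rightarrow> real" where
  "k7 v \<beta> p x =
     - A1 v \<beta> * x powr (- 4) - A3 v \<beta> p * x powr (- 4)
     - 1 / 2 * p 1 * student_cdf 3 (sqrt 3 * \<beta> 1) * x powr (- 4)"

definition omega7 :: "nat \<Rightarrow> (nat \<Rightarrow> real) \<Rightarrow> (nat \<Rightarrow> real) \<Rightarrow> (nat \<Rightarrow> real) \<Rightarrow> real \<Rightarrow> real" where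
  "omega7 r v \<beta> p x =
     - of_bool (4 < dof r v 3 \<and> dof r v 3 \<le> 6) * A5 v \<beta> p * x powr (- v 3)
     - of_bool (dof r v 3 \<ge> 6)
        * (A2 v \<beta> * x powr (- 6) + A3 v \<beta> p * p 1 * student_cdf 3 (sqrt 3 * \<beta> 1) * x powr (- 6)
           + p 1 * A1 v \<beta> * student_cdf 3 (sqrt 3 * \<beta> 1) * x powr (- 6)
           + 1 / 3 * (p 1)\<^sup>2 * (student_cdf 3 (sqrt 3 * \<beta> 1))\<^sup>2 * x powr (- 6)
           + A4 v \<beta> p * x powr (- 6) - (k7 v \<beta> p x)\<^sup>2 / 2)"

end

theory Submission
  imports Defs "HOL-Real_Asymp.Real_Asymp"
begin

text \<open>
  For fixed $x$, the power $F^n(a_n x)$ can be expressed through $y = a_n x$ alone. Because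
  $a_n^{v_1} = 2 \kappa n$, the exponent $n \ln F(y)$ equals
  $- x^{-v_1} (1 + R(y))$ with $R(y) = - y^{v_1} \ln F(y) / (2 \kappa) - 1$, so that
  $F^n(a_n x) = \Phi_{v_1}(x) \exp (- x^{-v_1} R(a_n x))$ and everything reduces to an
  expansion of the single function $R$ (called \<open>log_dev\<close> below) in powers of $1/y$.

  Three sources contribute to $R$. First, the tail of one skew-$t$ law is a constant times
  $y^{-v} (1 + c_1 y^{-2} + c_2 y^{-4} + o(y^{-4}))$ (\<open>skew_t_tail_expansion\<close>): after
  $s = y^{-2}$ the density is a power of $y$ times a function that is smooth at $s = 0$, and
  its Taylor polynomial is integrated by L'Hopital's rule. The constants $A_1$, $A_2$ are
  these coefficients for the first component. Second, the other components enter with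
  relative weights $A_3 y^{-(v_2 - v_1)}$, $A_5 y^{-(v_3 - v_1)}$ and corrections of their
  own, such as $A_4$ (\<open>tail_dev_expansion\<close>). Third, the logarithm turns the tail $u$
  into $u + u^2/2 + u^3/3 + \dots$, which produces the terms with $\kappa$
  (\<open>log_dev_expansion\<close>). All terms that can matter are collected in a finite list of
  coefficients and exponents, \<open>log_dev_terms\<close>.

  Let $\theta$ be the smallest exponent occurring and $m = \theta + \gamma$ the smallest number
  among the larger exponents and $2 \theta$. Then $R$ has a two-term expansion with exponents
  $\theta$ and $m$, and exponentiating it adds half the square of the first term exactly when
  $2 \theta = m$ (\<open>second_order_limit\<close>). The seven cases are the possible positions of $\theta$:
  it is attained by one of $v_1$ (logarithm), $2$ (tail correction) and $v_2 - v_1$ (second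
  component), or by two or three of them at once. In each case $\gamma$ is
  $m - \theta$, and the indicators tell which terms have order $m$.
\<close>

section \<open>Distribution functions of continuous densities\<close>

lemma density_cdf_has_derivative:
  fixes f :: "real \<Rightarrow> real"
  assumes cont: "continuous_on UNIV f" and nonneg: "\<And>x. 0 \<le> f x"
    and int: "integrable lborel f"
  shows "(cdf (density lborel (\<lambda>x. ennreal (f x))) has_real_derivative f x) (at x)"
proof -
  define M where "M = density lborel (\<lambda>x. ennreal (f x))"
  have meas [measurable]: "f \<in> borel_measurable borel"
    by (rule borel_measurable_continuous_onI[OF cont])
  have "emeasure M (space M) = ennreal (integral\<^sup>L lborel f)"
    unfolding M_def using nonneg int
    by (simp add: emeasure_density nn_integral_eq_integral)
  hence fin: "emeasure M (space M) \<noteq> \<infinity>" by simp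
  interpret finite_measure M using fin by (rule finite_measureI)
  interpret finite_borel_measure M
    by standard (simp add: M_def)
  have incr: "cdf M b = cdf M a + integral {a..b} f" if "a < b" for a b
  proof -
    have fi: "f integrable_on {a..b}"
      by (intro integrable_continuous_real continuous_on_subset[OF cont]) auto
    have "emeasure M {a<..b} = (\<integral>\<^sup>+x. ennreal (f x) * indicator {a<..b} x \<partial>lborel)"
      unfolding M_def by (subst emeasure_density) auto
    also have "\<dots> = (\<integral>\<^sup>+x. ennreal (f x) * indicator {a..b} x \<partial>lborel)"
    proof (rule nn_integral_cong_AE)
      show "AE x in lborel. ennreal (f x) * indicator {a<..b} x = ennreal (f x) * indicator {a..b} x"
        using AE_lborel_singleton[of a] by eventually_elim (simp add: indicator_def)
    qed
    also have "\<dots> = ennreal (integral {a..b} f)"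
      by (rule nn_integral_has_integral_lebesgue') (use fi nonneg in auto)
    finally have "measure M {a<..b} = integral {a..b} f"
      using nonneg fi by (simp add: measure_def integral_nonneg)
    thus ?thesis using cdf_diff_eq[OF that] by simp
  qed
  have "((\<lambda>y. cdf M (x - 1) + integral {x - 1..y} f) has_real_derivative f x)
          (at x within {x - 1..x + 1})"
    by (auto intro!: derivative_eq_intros integral_has_real_derivative continuous_on_subset[OF cont])
  hence "((\<lambda>y. cdf M (x - 1) + integral {x - 1..y} f) has_real_derivative f x) (at x)"
    by (simp add: at_within_Icc_at)
  thus ?thesis
    unfolding M_def[symmetric]
    by (rule has_field_derivative_transform_within[where d = 1]) (auto simp: dist_real_def incr[symmetric])
qed

lemma density_real_distribution:
  fixes f :: "real \<Rightarrow> real"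
  assumes [measurable]: "f \<in> borel_measurable borel" and nonneg: "\<And>x. 0 \<le> f x"
    and int: "integrable lborel f" and one: "integral\<^sup>L lborel f = 1"
  shows "real_distribution (density lborel (\<lambda>x. ennreal (f x)))"
proof -
  define M where "M = density lborel (\<lambda>x. ennreal (f x))"
  have "emeasure M (space M) = 1"
    unfolding M_def using nonneg int one
    by (simp add: emeasure_density nn_integral_eq_integral)
  then interpret prob_space M by (rule prob_spaceI)
  have "real_distribution M"
    by standard (simp_all add: M_def)
  thus ?thesis by (simp add: M_def)
qed

section \<open>The Student and the skew-t distribution\<close>

lemma student_const_pos: "v > 0 \<Longrightarrow> student_const v > 0"
  unfolding student_const_def by (intro divide_pos_pos mult_pos_pos Gamma_real_pos) auto

lemma one_plus_square_div_pos: "v > 0 \<Longrightarrow> 0 < 1 + x\<^sup>2 / (v :: real)"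
  by (intro add_pos_nonneg) auto

lemma student_pdf_pos: "v > 0 \<Longrightarrow> student_pdf v x > 0"
  unfolding student_pdf_def
  by (intro mult_pos_pos student_const_pos) (use one_plus_square_div_pos[of v x] in auto)

lemma continuous_student_pdf:
  assumes "v > 0"
  shows "continuous_on A (student_pdf v)"
proof -
  have "1 + x\<^sup>2 / v \<noteq> 0" for x
    using one_plus_square_div_pos[OF assms, of x] by linarith
  thus ?thesis
    unfolding student_pdf_def using assms by (intro continuous_intros) auto
qed

lemma student_pdf_measurable [measurable]: "student_pdf v \<in> borel_measurable borel"
  unfolding student_pdf_def by measurable

lemma student_pdf_minus: "student_pdf v (- x) = student_pdf v x"
  by (simp add: student_pdf_def)

lemma even_function_lborel_integral:
  fixes f :: "real \<Rightarrow> real"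
  assumes [measurable]: "f \<in> borel_measurable borel" and even: "\<And>x. f (- x) = f x"
    and half: "set_integrable lborel {0<..} f"
  shows "integrable lborel f" "integral\<^sup>L lborel f = 2 * (LBINT x:{0<..}. f x)"
proof -
  let ?g = "\<lambda>x. indicator {0<..} x * f x"
  have g: "integrable lborel ?g" using half by (simp add: set_integrable_def)
  have g': "integrable lborel (\<lambda>x. ?g (- x))"
    using lborel_integrable_real_affine[OF g, of "-1" 0] by simp
  have eq: "AE x in lborel. ?g x + ?g (- x) = f x"
    using AE_lborel_singleton[of "0::real"] by eventually_elim (auto simp: indicator_def even)
  have swap: "integral\<^sup>L lborel (\<lambda>x. ?g (- x)) = integral\<^sup>L lborel ?g"
    using lborel_integral_real_affine[of "-1" ?g 0] by simp
  have sum: "integrable lborel (\<lambda>x. ?g x + ?g (- x))"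
    using g g' by (rule Bochner_Integration.integrable_add)
  show "integrable lborel f"
    by (rule integrable_cong_AE_imp[OF sum]) (use eq in \<open>auto elim: eventually_mono\<close>)
  have "integral\<^sup>L lborel f = integral\<^sup>L lborel (\<lambda>x. ?g x + ?g (- x))"
    by (rule integral_cong_AE) (use eq in \<open>auto elim: eventually_mono\<close>)
  also have "\<dots> = 2 * integral\<^sup>L lborel ?g"
    using g g' swap by (subst Bochner_Integration.integral_add) auto
  finally show "integral\<^sup>L lborel f = 2 * (LBINT x:{0<..}. f x)"
    by (simp add: set_lebesgue_integral_def)
qed

text \<open>
  The substitution $x = \sqrt{v t / (1 - t)}$ maps $(0, 1)$ onto $(0, \infty)$ and turns
  $1 + x^2/v$ into $1/(1 - t)$, so the integrand becomes that of the Beta integral with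
  parameters $1/2$ and $v/2$.
\<close>

lemma student_kernel_half_integral:
  assumes v: "v > 0"
  shows "set_integrable lborel {0<..} (\<lambda>x. (1 + x\<^sup>2 / v) powr (- ((v + 1) / 2)))" (is "set_integrable _ _ ?f")
    and "(LBINT x:{0<..}. (1 + x\<^sup>2 / v) powr (- ((v + 1) / 2))) = sqrt v / 2 * Beta (1 / 2) (v / 2)"
proof -
  \<comment> \<open>The substitution and its derivative; \<open>h\<close> is the transformed integrand.\<close>
  define g where "g t = sqrt v * (t powr (1 / 2) * (1 - t) powr (- (1 / 2)))" for t :: real
  define g' where "g' t = sqrt v / 2 * (t powr (- (1 / 2)) * (1 - t) powr (- (3 / 2)))" for t :: real
  define h where "h t = sqrt v / 2 * (t powr (1 / 2 - 1) * (1 - t) powr (v / 2 - 1))" for t :: real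
  have fg: "?f (g t) * g' t = h t" if "0 < t" "t < 1" for t
  proof -
    have "(g t)\<^sup>2 / v = t / (1 - t)"
      using that v by (simp add: g_def power_mult_distrib powr_power powr_minus divide_simps)
    hence "1 + (g t)\<^sup>2 / v = (1 - t) powr (- 1)"
      using that by (simp add: powr_minus) (simp add: field_simps)
    hence "?f (g t) = (1 - t) powr ((v + 1) / 2)"
      by (simp only: powr_powr) (simp add: minus_divide_left add.commute)
    moreover have "(1 - t) powr ((v + 1) / 2) * (1 - t) powr (- (3 / 2)) = (1 - t) powr (v / 2 - 1)"
    proof -
      have "v / 2 - 1 = (v + 1) / 2 + - (3 / 2)" by (simp add: field_simps)
      thus ?thesis by (simp only: powr_add)
    qed
    ultimately show ?thesis
      by (simp add: g'_def h_def mult_ac)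
  qed
  have deriv: "(g has_real_derivative g' t) (at t)" if "0 < t" "t < 1" for t
  proof -
    have "(g has_real_derivative sqrt v * ((1/2) * t powr (1/2 - 1) * (1 - t) powr (- (1 / 2))
             + t powr (1/2) * (1/2) * (1 - t) powr (- (1/2) - 1))) (at t)"
      unfolding g_def using that by (auto intro!: derivative_eq_intros)
    also have "(1/2) * t powr (1/2 - 1) * (1 - t) powr (- (1 / 2))
        + t powr (1/2) * (1/2) * (1 - t) powr (- (1/2) - 1)
        = (1/2) * (t powr (- (1 / 2)) * (1 - t) powr (- (3/2))) * ((1 - t) + t)"
    proof -
      have e1: "(1 - t) powr (- (1 / 2)) = (1 - t) powr (- (3/2)) * (1 - t)"
        using that powr_mult_base[of "1 - t" "- (3/2)"] by (simp add: mult_ac)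
      have e2: "t powr (1 / 2) = t powr (- (1/2)) * t"
        using that powr_mult_base[of "t" "- (1/2)"] by (simp add: mult_ac)
      have e3: "1 / 2 - 1 = - (1 / 2 :: real)" "- (1 / 2) - 1 = - (3 / 2 :: real)" by simp_all
      show ?thesis by (simp only: e1 e2 e3) algebra
    qed
    finally show ?thesis by (simp add: g'_def)
  qed
  have int_h: "set_integrable lborel {0..1} h"
    unfolding h_def by (intro set_integrable_mult_right integrable_Beta) (use v in auto)
  have int: "set_integrable lborel (einterval 0 1) (\<lambda>t. ?f (g t) * g' t)"
  proof -
    have "set_integrable lborel {0<..<1} h"
      by (rule set_integrable_subset[OF int_h]) auto
    thus ?thesis
      by (rule set_integrable_cong[THEN iffD1, rotated -1]) (auto simp: fg zero_ereal_def one_ereal_def)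
  qed
  have lim0: "((ereal \<circ> g \<circ> real_of_ereal) \<longlongrightarrow> 0) (at_right 0)"
  proof -
    have "((\<lambda>t. g t) \<longlongrightarrow> 0) (at_right 0)"
      unfolding g_def by real_asymp
    thus ?thesis unfolding zero_ereal_def
      by (simp add: ereal_tendsto_simps)
  qed
  have lim1: "((ereal \<circ> g \<circ> real_of_ereal) \<longlongrightarrow> \<infinity>) (at_left 1)"
  proof -
    have "filterlim g at_top (at_left 1)"
      unfolding g_def using v by real_asymp
    thus ?thesis unfolding one_ereal_def
      by (simp add: ereal_tendsto_simps)
  qed
  have cont: "isCont ?f y" for y
    by (intro continuous_intros) (use v one_plus_square_div_pos[OF v, of y] in auto)
  have cont': "isCont g' t" if "0 < t" "t < 1" for t
    unfolding g'_def using that by (intro continuous_intros) auto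
  have g'_nonneg: "0 \<le> g' t" for t
    using v by (simp add: g'_def)
  have f_nonneg: "0 \<le> ?f y" for y
    by simp
  have less: "(0::ereal) < 1" by simp
  have range: "0 < t \<and> t < 1" if "0 < ereal t" "ereal t < 1" for t
    using that by (simp add: zero_ereal_def one_ereal_def)
  note subst = interval_integral_substitution_nonneg[where f = ?f and g = g and g' = g' and a = 0 and b = 1
      and A = 0 and B = \<infinity>]
  have 1: "set_integrable lborel (einterval 0 \<infinity>) ?f"
    by (rule subst(1)) (use less deriv cont cont' range g'_nonneg f_nonneg lim0 lim1 int in blast)+
  have 2: "(LBINT x=0..\<infinity>. ?f x) = (LBINT t=0..1. ?f (g t) * g' t)"
    by (rule subst(2)) (use less deriv cont cont' range g'_nonneg f_nonneg lim0 lim1 int in blast)+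
  show "set_integrable lborel {0<..} ?f"
    using 1 by (simp add: zero_ereal_def)
  have "(LBINT x:{0<..}. ?f x) = (LBINT t=0..1. ?f (g t) * g' t)"
    using 2 by (simp add: zero_ereal_def interval_lebesgue_integral_def)
  also have "\<dots> = (LBINT t:{0<..<1}. h t)"
    unfolding interval_lebesgue_integral_def
    by (auto simp: zero_ereal_def one_ereal_def fg intro!: set_lebesgue_integral_cong)
  also have "\<dots> = (LBINT t:{0..1}. h t)"
  proof -
    have "AE t in lborel. t \<noteq> 0 \<and> t \<noteq> (1::real)"
      using AE_lborel_singleton[of "0::real"] AE_lborel_singleton[of "1::real"] by eventually_elim auto
    hence "AE t in lborel. (t \<in> {0<..<1}) = (t \<in> {0..(1::real)})" by eventually_elim auto
    thus ?thesis by (intro set_integral_cong_set) (auto simp: set_borel_measurable_def h_def)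
  qed
  also have "\<dots> = integral {0..1} h"
    by (rule set_borel_integral_eq_integral(2)[OF int_h])
  also have "\<dots> = sqrt v / 2 * Beta (1 / 2) (v / 2)"
    unfolding h_def using has_integral_Beta_real[of "1 / 2" "v / 2"] v
    by (intro integral_unique has_integral_mult_right) simp
  finally show "(LBINT x:{0<..}. ?f x) = sqrt v / 2 * Beta (1 / 2) (v / 2)" .
qed

lemma student_pdf_integral:
  assumes v: "v > 0"
  shows "integrable lborel (student_pdf v)" "integral\<^sup>L lborel (student_pdf v) = 1"
proof -
  let ?f = "\<lambda>x. (1 + x\<^sup>2 / v) powr (- ((v + 1) / 2))"
  note half = student_kernel_half_integral[OF v]
  have even: "integrable lborel ?f" "integral\<^sup>L lborel ?f = 2 * (LBINT x:{0<..}. ?f x)"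
    using half(1) by (intro even_function_lborel_integral; simp)+
  show "integrable lborel (student_pdf v)"
    unfolding student_pdf_def using even(1) by simp
  have "Gamma (v / 2) > 0" "Gamma (1 / 2 + v / 2) > 0"
    by (rule Gamma_real_pos; use v in simp)+
  hence nz: "Gamma (v / 2) \<noteq> 0" "Gamma (1 / 2 + v / 2) \<noteq> 0"
    by linarith+
  have "integral\<^sup>L lborel (student_pdf v) = student_const v * (sqrt v * Beta (1 / 2) (v / 2))"
    unfolding student_pdf_def using even half(2) by simp
  also have "student_const v * (sqrt v * Beta (1 / 2) (v / 2)) = 1"
    using v nz
    by (simp add: student_const_def Beta_def Gamma_one_half_real real_sqrt_mult add_divide_distrib add.commute)
  finally show "integral\<^sup>L lborel (student_pdf v) = 1" .
qed

lemma student_cdf_has_derivative: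
  "v > 0 \<Longrightarrow> (student_cdf v has_real_derivative student_pdf v x) (at x)"
  unfolding student_cdf_def
  by (rule density_cdf_has_derivative)
     (auto intro!: continuous_student_pdf student_pdf_integral less_imp_le[OF student_pdf_pos])

lemma student_real_distribution:
  "v > 0 \<Longrightarrow> real_distribution (density lborel (\<lambda>x. ennreal (student_pdf v x)))"
  by (rule density_real_distribution)
     (auto intro!: student_pdf_integral less_imp_le[OF student_pdf_pos])

lemma student_cdf_tendsto_1: "v > 0 \<Longrightarrow> (student_cdf v \<longlongrightarrow> 1) at_top"
  unfolding student_cdf_def
  by (intro real_distribution.cdf_lim_at_top_prob student_real_distribution)

lemma student_cdf_tendsto_0: "v > 0 \<Longrightarrow> (student_cdf v \<longlongrightarrow> 0) at_bot"
  unfolding student_cdf_def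
  by (intro finite_borel_measure.cdf_lim_at_bot real_distribution.finite_borel_measure_M
        student_real_distribution)

lemma continuous_student_cdf: "v > 0 \<Longrightarrow> continuous_on A (student_cdf v)"
  by (intro continuous_at_imp_continuous_on ballI DERIV_isCont[OF student_cdf_has_derivative])

lemma student_cdf_pos:
  assumes "v > 0"
  shows "student_cdf v x > 0"
proof -
  have "student_cdf v (x - 1) < student_cdf v x"
  proof (rule DERIV_pos_imp_increasing[where f = "student_cdf v"])
    show "\<exists>d. (student_cdf v has_real_derivative d) (at y) \<and> d > 0" for y
      using student_cdf_has_derivative[OF assms] student_pdf_pos[OF assms] by blast
  qed simp
  moreover have "student_cdf v (x - 1) \<ge> 0"
    by (simp add: student_cdf_def cdf_def)
  ultimately show ?thesis by linarith
qed

text \<open>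
  The density is even, so the left-hand side has derivative $0$ in $x$; its value is read off at
  infinity.
\<close>

lemma student_cdf_plus_minus:
  assumes v: "v > 0"
  shows "student_cdf v x + student_cdf v (- x) = 1"
proof -
  let ?g = "\<lambda>y. student_cdf v y + student_cdf v (- y)"
  have "(?g has_real_derivative 0) (at y)" for y
    by (auto intro!: derivative_eq_intros student_cdf_has_derivative[OF v]
          DERIV_chain2[OF student_cdf_has_derivative[OF v]] simp: student_pdf_minus)
  hence const: "?g y = ?g z" for y z
    using DERIV_isconst_all by blast
  have "((\<lambda>y. student_cdf v (- y)) \<longlongrightarrow> 0) at_top"
    using student_cdf_tendsto_0[OF v]
    by (rule filterlim_compose) (rule filterlim_uminus_at_bot_at_top)
  from tendsto_add[OF student_cdf_tendsto_1[OF v] this]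
  have "(?g \<longlongrightarrow> 1) at_top" by simp
  moreover have "?g = (\<lambda>_. ?g x)" using const by auto
  ultimately show ?thesis
    by (metis tendsto_const_iff trivial_limit_at_top_linorder)
qed

lemma skew_t_pdf_nonneg: "v > 0 \<Longrightarrow> skew_t_pdf v b x \<ge> 0"
  unfolding skew_t_pdf_def
  by (intro mult_nonneg_nonneg less_imp_le[OF student_cdf_pos] less_imp_le[OF student_pdf_pos]) auto

lemma continuous_skew_t_pdf:
  assumes v: "v > 0"
  shows "continuous_on UNIV (skew_t_pdf v b)"
proof -
  have "x\<^sup>2 + v \<noteq> 0" for x
    using v zero_le_power2[of x] by linarith
  hence "continuous_on UNIV (\<lambda>x. b * x * sqrt ((v + 1) / (x\<^sup>2 + v)))"
    by (intro continuous_intros) auto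
  hence "continuous_on UNIV (\<lambda>x. student_cdf (v + 1) (b * x * sqrt ((v + 1) / (x\<^sup>2 + v))))"
    by (rule continuous_on_compose2[OF continuous_student_cdf[where A = UNIV], rotated]) (use v in auto)
  thus ?thesis
    unfolding skew_t_pdf_def
    by (rule continuous_on_mult[OF continuous_on_mult[OF continuous_on_const continuous_student_pdf[OF v]]])
qed

text \<open>
  The argument of the skewing factor is an odd function of $x$. Hence reflection replaces the
  factor by its complement to $1$, which is also why the skew-$t$ density has total mass $1$.
\<close>

lemma skew_t_pdf_plus_minus:
  "v > 0 \<Longrightarrow> skew_t_pdf v b x + skew_t_pdf v b (- x) = 2 * student_pdf v x"
  using student_cdf_plus_minus[of "v + 1" "b * x * sqrt ((v + 1) / (x\<^sup>2 + v))"]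
  by (simp add: skew_t_pdf_def student_pdf_minus flip: distrib_left)

lemma skew_t_pdf_integral:
  assumes v: "v > 0"
  shows "integrable lborel (skew_t_pdf v b)" "integral\<^sup>L lborel (skew_t_pdf v b) = 1"
proof -
  let ?f = "skew_t_pdf v b"
  have [measurable]: "?f \<in> borel_measurable borel"
    by (rule borel_measurable_continuous_onI[OF continuous_skew_t_pdf[OF v]])
  show int: "integrable lborel ?f"
  proof (rule Bochner_Integration.integrable_bound)
    show "integrable lborel (\<lambda>x. 2 * student_pdf v x)"
      using student_pdf_integral[OF v] by simp
    show "AE x in lborel. norm (?f x) \<le> norm (2 * student_pdf v x)"
    proof (rule AE_I2)
      fix x
      show "norm (?f x) \<le> norm (2 * student_pdf v x)"
        using skew_t_pdf_plus_minus[OF v, of b x] skew_t_pdf_nonneg[OF v, of b x]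
          skew_t_pdf_nonneg[OF v, of b "- x"] by simp
    qed
  qed simp
  have int': "integrable lborel (\<lambda>x. ?f (- x))"
    using lborel_integrable_real_affine[OF int, of "-1" 0] by simp
  have "integral\<^sup>L lborel (\<lambda>x. ?f (- x)) = integral\<^sup>L lborel ?f"
    using lborel_integral_real_affine[of "-1" ?f 0] by simp
  hence "2 * integral\<^sup>L lborel ?f = integral\<^sup>L lborel (\<lambda>x. ?f x + ?f (- x))"
    using int int' by simp
  also have "\<dots> = 2"
    using student_pdf_integral[OF v] by (simp add: skew_t_pdf_plus_minus[OF v])
  finally show "integral\<^sup>L lborel ?f = 1" by simp
qed

lemma skew_t_cdf_has_derivative:
  "v > 0 \<Longrightarrow> (skew_t_cdf v b has_real_derivative skew_t_pdf v b x) (at x)"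
  unfolding skew_t_cdf_def
  by (rule density_cdf_has_derivative)
     (auto intro!: continuous_skew_t_pdf skew_t_pdf_integral skew_t_pdf_nonneg)

lemma skew_t_cdf_tendsto_1: "v > 0 \<Longrightarrow> (skew_t_cdf v b \<longlongrightarrow> 1) at_top"
  unfolding skew_t_cdf_def
  by (intro real_distribution.cdf_lim_at_top_prob density_real_distribution skew_t_pdf_integral
        skew_t_pdf_nonneg borel_measurable_continuous_onI[OF continuous_skew_t_pdf])

section \<open>Second-order expansion of the skew-t tail\<close>

text \<open>
  A second-order Taylor formula with Peano remainder that needs the second derivative only at the
  end point: one application of L'Hopital's rule leaves the difference quotient of $h'$ at $0$.
\<close>

lemma taylor2_at_right_0:
  fixes h h' :: "real \<Rightarrow> real"
  assumes h: "\<And>s. s \<ge> 0 \<Longrightarrow> (h has_real_derivative h' s) (at s)"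
    and h': "(h' has_real_derivative c) (at 0)"
  shows "((\<lambda>s. (h s - h 0 - h' 0 * s - c / 2 * s\<^sup>2) / s\<^sup>2) \<longlongrightarrow> 0) (at_right 0)"
proof (rule lhopital_right_0[where f' = "\<lambda>s. h' s - h' 0 - c * s" and g' = "\<lambda>s. 2 * s"])
  have "isCont h 0" using h[of 0] DERIV_isCont by auto
  hence "(h \<longlongrightarrow> h 0) (at_right 0)"
    by (metis continuous_at_imp_continuous_at_within continuous_within)
  hence "((\<lambda>s. h s - h 0 - h' 0 * s - c / 2 * s\<^sup>2) \<longlongrightarrow> h 0 - h 0 - h' 0 * 0 - c / 2 * 0\<^sup>2) (at_right 0)"
    by (intro tendsto_intros)
  thus "((\<lambda>s. h s - h 0 - h' 0 * s - c / 2 * s\<^sup>2) \<longlongrightarrow> 0) (at_right 0)" by simp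
  have "((\<lambda>s::real. s\<^sup>2) \<longlongrightarrow> 0\<^sup>2) (at_right 0)" by (intro tendsto_intros)
  thus "((\<lambda>s::real. s\<^sup>2) \<longlongrightarrow> 0) (at_right 0)" by simp
  show "eventually (\<lambda>s::real. s\<^sup>2 \<noteq> 0) (at_right 0)" "eventually (\<lambda>s::real. 2 * s \<noteq> 0) (at_right 0)"
    by (auto simp: eventually_at_right_less eventually_at_filter)
  show "eventually (\<lambda>s. ((\<lambda>s. h s - h 0 - h' 0 * s - c / 2 * s\<^sup>2) has_real_derivative h' s - h' 0 - c * s) (at s)) (at_right 0)"
    using eventually_at_right_less[of "0::real"]
  proof eventually_elim
    case (elim s)
    show ?case using elim by (auto intro!: derivative_eq_intros h)
  qed
  show "eventually (\<lambda>s::real. (power2 has_real_derivative 2 * s) (at s)) (at_right 0)"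
    by (intro always_eventually allI) (auto intro!: derivative_eq_intros)
  have "((\<lambda>s. (h' s - h' 0) / s) \<longlongrightarrow> c) (at 0)"
    using h' by (simp add: DERIV_def)
  hence "((\<lambda>s. (h' s - h' 0) / s) \<longlongrightarrow> c) (at_right 0)"
    by (rule filterlim_mono) (auto simp: at_le)
  hence "((\<lambda>s. ((h' s - h' 0) / s - c) / 2) \<longlongrightarrow> (c - c) / 2) (at_right 0)"
    by (intro tendsto_intros) auto
  hence "((\<lambda>s. ((h' s - h' 0) / s - c) / 2) \<longlongrightarrow> 0) (at_right 0)" by simp
  thus "((\<lambda>s. (h' s - h' 0 - c * s) / (2 * s)) \<longlongrightarrow> 0) (at_right 0)"
    by (rule Lim_transform_eventually)
       (use eventually_at_right_less[of "0::real"] in \<open>eventually_elim, simp add: field_simps\<close>)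
qed

text \<open>
  An estimate of a derivative at infinity is integrated to one of a function vanishing there. With
  $y = 1/s$ this is L'Hopital's rule for the quotient of $D(1/s)$ and $s^q$ at $0$.
\<close>

lemma powr_tail_from_derivative:
  fixes D D' :: "real \<Rightarrow> real"
  assumes q: "q > 0" and D: "\<And>y. y > 0 \<Longrightarrow> (D has_real_derivative D' y) (at y)"
    and D0: "(D \<longlongrightarrow> 0) at_top"
    and D': "((\<lambda>y. y powr (q + 1) * D' y) \<longlongrightarrow> 0) at_top"
  shows "((\<lambda>y. y powr q * D y) \<longlongrightarrow> 0) at_top"
proof -
  have pos: "eventually (\<lambda>s. s > 0) (at_right (0::real))"
    by (rule eventually_at_right_less)
  have "((\<lambda>s. D (inverse s) / s powr q) \<longlongrightarrow> 0) (at_right 0)"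
  proof (rule lhopital_right_0[where f' = "\<lambda>s. - D' (inverse s) / s\<^sup>2" and g' = "\<lambda>s. q * s powr (q - 1)"])
    show "((\<lambda>s. D (inverse s)) \<longlongrightarrow> 0) (at_right 0)"
      using D0 by (simp add: filterlim_at_top_to_right)
    show "((\<lambda>s. s powr q) \<longlongrightarrow> 0) (at_right 0)"
      using q by real_asymp
    show "\<forall>\<^sub>F s in at_right 0. s powr q \<noteq> 0" "\<forall>\<^sub>F s in at_right 0. q * s powr (q - 1) \<noteq> 0"
      using pos by (eventually_elim, use q in simp)+
    show "\<forall>\<^sub>F s in at_right 0. ((\<lambda>s. D (inverse s)) has_real_derivative - D' (inverse s) / s\<^sup>2) (at s)"
      using pos
    proof eventually_elim
      case (elim s)
      have "(inverse has_real_derivative - (inverse s ^ Suc (Suc 0))) (at s)"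
        using elim by (intro DERIV_inverse) auto
      moreover have "(D has_real_derivative D' (inverse s)) (at (inverse s))"
        using elim by (intro D) auto
      ultimately have "((\<lambda>s. D (inverse s)) has_real_derivative
          D' (inverse s) * - (inverse s ^ Suc (Suc 0))) (at s)"
        by (intro DERIV_chain2[where f = D and g = inverse])
      thus ?case
        by (rule DERIV_cong) (simp add: power2_eq_square field_simps)
    qed
    show "\<forall>\<^sub>F s in at_right 0. ((\<lambda>s. s powr q) has_real_derivative q * s powr (q - 1)) (at s)"
      using pos by eventually_elim (auto intro!: derivative_eq_intros)
    have "((\<lambda>s. inverse s powr (q + 1) * D' (inverse s)) \<longlongrightarrow> 0) (at_right 0)"
      using D' by (simp add: filterlim_at_top_to_right)
    from tendsto_mult[OF tendsto_const[of "- inverse q"] this]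
    have "((\<lambda>s. - inverse q * (inverse s powr (q + 1) * D' (inverse s))) \<longlongrightarrow> 0) (at_right 0)"
      by simp
    thus "((\<lambda>s. (- D' (inverse s) / s\<^sup>2) / (q * s powr (q - 1))) \<longlongrightarrow> 0) (at_right 0)"
    proof (rule Lim_transform_eventually)
      show "\<forall>\<^sub>F s in at_right 0. - inverse q * (inverse s powr (q + 1) * D' (inverse s))
              = (- D' (inverse s) / s\<^sup>2) / (q * s powr (q - 1))"
        using pos
      proof eventually_elim
        case (elim s)
        have "s\<^sup>2 * s powr (q - 1) = s powr (q + 1)"
          using elim by (simp add: powr_add[symmetric] add.commute flip: powr_numeral)
        thus ?case using elim q
          by (simp add: powr_divide divide_simps mult_ac)
      qed
    qed
  qed
  hence "((\<lambda>s. inverse s powr q * D (inverse s)) \<longlongrightarrow> 0) (at_right 0)"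
    by (rule Lim_transform_eventually)
       (use pos in \<open>eventually_elim, simp add: powr_divide divide_simps\<close>)
  thus ?thesis by (simp add: filterlim_at_top_to_right)
qed

text \<open>
  In the variable $s = y^{-2}$ the skew-$t$ density is a power of $y$ times this function, which
  is smooth up to $s = 0$, the point that corresponds to $y = \infty$.
\<close>

definition skew_kernel :: "real \<Rightarrow> real \<Rightarrow> real \<Rightarrow> real" where
  "skew_kernel v b s = (1 + v * s) powr (- ((v + 1) / 2))
     * student_cdf (v + 1) (b * sqrt (v + 1) * (1 + v * s) powr (- (1 / 2)))"

definition skew_kernel_deriv :: "real \<Rightarrow> real \<Rightarrow> real \<Rightarrow> real" where
  "skew_kernel_deriv v b s =
     - (v * (v + 1) / 2) * (1 + v * s) powr (- ((v + 3) / 2))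
        * student_cdf (v + 1) (b * sqrt (v + 1) * (1 + v * s) powr (- (1 / 2)))
     - v / 2 * b * sqrt (v + 1) * student_const (v + 1)
        * (1 + v * s) powr (- 1) * (1 + b\<^sup>2 + v * s) powr (- ((v + 2) / 2))"

lemma skew_t_pdf_eq_kernel:
  assumes v: "v > 0" and y: "y > 0"
  shows "skew_t_pdf v b y = 2 * student_const v * v powr ((v + 1) / 2) * y powr (- (v + 1))
           * skew_kernel v b (y powr (- 2))"
proof -
  have s: "y powr (- 2) = 1 / y\<^sup>2"
    using y by (simp add: powr_minus powr_numeral inverse_eq_divide)
  have "1 + y\<^sup>2 / v = y\<^sup>2 / v * (1 + v * y powr (- 2))"
    using y v unfolding s by (simp add: field_simps)
  hence "(1 + y\<^sup>2 / v) powr (- ((v + 1) / 2))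
     = (y\<^sup>2 / v) powr (- ((v + 1) / 2)) * (1 + v * y powr (- 2)) powr (- ((v + 1) / 2))"
    using y v by (simp only:, subst powr_mult) auto
  also have "(y\<^sup>2 / v) powr (- ((v + 1) / 2)) = y powr (- (v + 1)) * v powr ((v + 1) / 2)"
  proof -
    have "(y\<^sup>2) powr a = y powr (2 * a)" for a
      using y by (simp add: powr_powr flip: powr_numeral)
    moreover have "2 * - ((v + 1) / 2) = - (v + 1)"
      by (simp add: field_simps)
    ultimately have "(y\<^sup>2) powr (- ((v + 1) / 2)) = y powr (- (v + 1))"
      by metis
    moreover have "(y\<^sup>2 / v) powr (- a) = (y\<^sup>2) powr (- a) * v powr a" for a
      using v y by (simp add: powr_divide powr_minus_divide)
    ultimately show ?thesis by metis
  qed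
  finally have 1: "(1 + y\<^sup>2 / v) powr (- ((v + 1) / 2)) = y powr (- (v + 1)) * v powr ((v + 1) / 2)
      * (1 + v * y powr (- 2)) powr (- ((v + 1) / 2))" .
  have "y * sqrt ((v + 1) / (y\<^sup>2 + v)) = sqrt (v + 1) * (1 + v * y powr (- 2)) powr (- (1 / 2))"
  proof -
    have "(1 + v * y powr (- 2)) powr (- (1 / 2)) = 1 / sqrt (1 + v / y\<^sup>2)"
      unfolding s using v y by (simp add: powr_minus powr_half_sqrt add_nonneg_nonneg inverse_eq_divide)
    also have "1 + v / y\<^sup>2 = (y\<^sup>2 + v) / y\<^sup>2" using y by (simp add: field_simps)
    also have "1 / sqrt ((y\<^sup>2 + v) / y\<^sup>2) = y / sqrt (y\<^sup>2 + v)" using y by (simp add: real_sqrt_divide)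
    finally show ?thesis by (simp add: real_sqrt_divide)
  qed
  hence 2: "b * y * sqrt ((v + 1) / (y\<^sup>2 + v)) = b * sqrt (v + 1) * (1 + v * y powr (- 2)) powr (- (1 / 2))"
    by (simp add: mult.assoc)
  show ?thesis
    unfolding skew_t_pdf_def student_pdf_def skew_kernel_def 1 2 by (simp add: mult_ac)
qed

text \<open>
  At the argument $w$ of the skewing factor, $1 + w^2/(v+1) = (1 + b^2 + v s)/(1 + v s)$. The
  term that the chain rule contributes to the derivative of the kernel therefore becomes an
  elementary function of $s$, which can be differentiated once more.
\<close>

lemma student_pdf_at_skew_argument:
  assumes v: "v > 0" and s: "s \<ge> 0"
  shows "(1 + v * s) powr (- ((v + 4) / 2)) * student_pdf (v + 1) (b * sqrt (v + 1) * (1 + v * s) powr (- (1 / 2)))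
     = student_const (v + 1) * (1 + v * s) powr (- 1) * (1 + b\<^sup>2 + v * s) powr (- ((v + 2) / 2))"
proof -
  have pos: "1 + v * s > 0" using v s by (simp add: add_pos_nonneg)
  define z where "z = (1 + v * s) powr (- (1 / 2))"
  have z: "z\<^sup>2 = 1 / (1 + v * s)"
    using pos by (simp add: z_def powr_minus_divide powr_half_sqrt power_divide)
  have "(b * sqrt (v + 1) * z)\<^sup>2 / (v + 1) = b\<^sup>2 * z\<^sup>2"
    using v by (simp add: power_mult_distrib)
  hence "1 + (b * sqrt (v + 1) * z)\<^sup>2 / (v + 1) = 1 + b\<^sup>2 * (1 / (1 + v * s))"
    unfolding z by simp
  hence "1 + (b * sqrt (v + 1) * z)\<^sup>2 / (v + 1) = (1 + b\<^sup>2 + v * s) / (1 + v * s)"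
    using pos by (simp add: field_simps)
  hence "student_pdf (v + 1) (b * sqrt (v + 1) * (1 + v * s) powr (- (1 / 2)))
     = student_const (v + 1) * ((1 + b\<^sup>2 + v * s) powr (- ((v + 2) / 2)) / (1 + v * s) powr (- ((v + 2) / 2)))"
    unfolding z_def[symmetric] using pos by (simp add: student_pdf_def powr_divide add.commute)
  moreover have "(1 + v * s) powr (- ((v + 4) / 2)) = (1 + v * s) powr (- 1) * (1 + v * s) powr (- ((v + 2) / 2))"
  proof -
    have "- ((v + 4) / 2) = - 1 + - ((v + 2) / 2)" by (simp add: field_simps)
    thus ?thesis by (simp only: powr_add)
  qed
  ultimately show ?thesis using pos by simp
qed

lemma skew_kernel_has_derivative:
  assumes v: "v > 0" and s: "s \<ge> 0"
  shows "(skew_kernel v b has_real_derivative skew_kernel_deriv v b s) (at s)"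
proof -
  have pos: "1 + v * s > 0" using v s by (simp add: add_pos_nonneg)
  let ?w = "b * sqrt (v + 1) * (1 + v * s) powr (- (1 / 2))"
  have "(skew_kernel v b has_real_derivative
      (- ((v + 1) / 2) * (1 + v * s) powr (- ((v + 1) / 2) - 1) * v) * student_cdf (v + 1) ?w
      + (1 + v * s) powr (- ((v + 1) / 2)) * (student_pdf (v + 1) ?w
          * (b * sqrt (v + 1) * (- (1 / 2) * (1 + v * s) powr (- (1 / 2) - 1) * v)))) (at s)"
    unfolding skew_kernel_def
    by (rule derivative_eq_intros DERIV_chain2[OF student_cdf_has_derivative] | use pos v in simp)+
  also have "- ((v + 1) / 2) - 1 = - ((v + 3) / 2)" by (simp add: field_simps)
  also have "(1 + v * s) powr (- ((v + 1) / 2)) * (student_pdf (v + 1) ?w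
          * (b * sqrt (v + 1) * (- (1 / 2) * (1 + v * s) powr (- (1 / 2) - 1) * v)))
     = - (v / 2) * b * sqrt (v + 1) * ((1 + v * s) powr (- ((v + 4) / 2)) * student_pdf (v + 1) ?w)"
  proof -
    have "(1 + v * s) powr (- ((v + 4) / 2)) = (1 + v * s) powr (- ((v + 1) / 2)) * (1 + v * s) powr (- (1 / 2) - 1)"
    proof -
      have "- ((v + 4) / 2) = - ((v + 1) / 2) + (- (1 / 2) - 1)" by (simp add: field_simps)
      thus ?thesis by (simp only: powr_add)
    qed
    thus ?thesis by simp
  qed
  finally show ?thesis
    unfolding student_pdf_at_skew_argument[OF v s] skew_kernel_deriv_def by (simp add: mult_ac)
qed

lemma skew_kernel_deriv_has_derivative_at_0:
  assumes v: "v > 0"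
  shows "(skew_kernel_deriv v b has_real_derivative
      v\<^sup>2 * (v + 1) * (v + 3) / 4 * student_cdf (v + 1) (b * sqrt (v + 1))
      + v\<^sup>2 / 4 * (2 * v + 5 - (v + 2) * b\<^sup>2 / (1 + b\<^sup>2)) * b * sqrt (v + 1) * student_const (v + 1)
        * (1 + b\<^sup>2) powr (- ((v + 2) / 2))) (at 0)"
proof -
  have b: "1 + b\<^sup>2 > 0" by (simp add: add_pos_nonneg)
  let ?w = "b * sqrt (v + 1)"
  have t: "student_pdf (v + 1) ?w = student_const (v + 1) * (1 + b\<^sup>2) powr (- ((v + 2) / 2))"
    using student_pdf_at_skew_argument[OF v, of 0 b] by simp
  have d1: "((\<lambda>s. (1 + v * s) powr a) has_real_derivative a * v) (at 0)" for a
    by (auto intro!: derivative_eq_intros)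
  have d2: "((\<lambda>s. student_cdf (v + 1) (?w * (1 + v * s) powr (- (1 / 2)))) has_real_derivative
      student_pdf (v + 1) ?w * (?w * (- (1 / 2) * v))) (at 0)"
    by (rule DERIV_chain2[where f = "student_cdf (v + 1)"])
       (use DERIV_cmult[OF d1[of "- (1 / 2)"], of ?w] student_cdf_has_derivative[of "v + 1" ?w] v in auto)
  have d3: "((\<lambda>s. (1 + b\<^sup>2 + v * s) powr a) has_real_derivative a * (1 + b\<^sup>2) powr (a - 1) * v) (at 0)" for a
    using b by (auto intro!: derivative_eq_intros)
  \<comment> \<open>With $b^2/(1+b^2) = 1 - i$ the second derivative is polynomial in the remaining quantities.\<close>
  define i r where "i = 1 / (1 + b\<^sup>2)" and "r = (1 + b\<^sup>2) powr (- ((v + 2) / 2))"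
  have r: "(1 + b\<^sup>2) powr (- ((v + 2) / 2) - 1) = r * i"
    using b unfolding r_def i_def by (simp only: powr_diff) simp
  have i: "b\<^sup>2 / (1 + b\<^sup>2) = 1 - i"
    using b by (simp add: i_def field_simps)
  have "(skew_kernel_deriv v b has_real_derivative
      - (v * (v + 1) / 2) * (- ((v + 3) / 2) * v) * student_cdf (v + 1) ?w
      + student_const (v + 1) * r * (?w * (- (1 / 2) * v)) * (- (v * (v + 1) / 2))
      - (v / 2 * b * sqrt (v + 1) * student_const (v + 1) * (- 1 * v) * r
         + - ((v + 2) / 2) * (r * i) * v * (v / 2 * b * sqrt (v + 1) * student_const (v + 1)))) (at 0)"
    using DERIV_diff[OF DERIV_mult[OF DERIV_cmult[OF d1[of "- ((v + 3) / 2)"], of "- (v * (v + 1) / 2)"] d2]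
      DERIV_mult[OF DERIV_cmult[OF d1[of "- 1"], of "v / 2 * b * sqrt (v + 1) * student_const (v + 1)"]
        d3[of "- ((v + 2) / 2)"]]]
    unfolding skew_kernel_deriv_def r t by (simp add: r_def mult.assoc)
  also have "- (v * (v + 1) / 2) * (- ((v + 3) / 2) * v) * student_cdf (v + 1) ?w
      + student_const (v + 1) * r * (?w * (- (1 / 2) * v)) * (- (v * (v + 1) / 2))
      - (v / 2 * b * sqrt (v + 1) * student_const (v + 1) * (- 1 * v) * r
         + - ((v + 2) / 2) * (r * i) * v * (v / 2 * b * sqrt (v + 1) * student_const (v + 1)))
    = v\<^sup>2 * (v + 1) * (v + 3) / 4 * student_cdf (v + 1) ?w
      + v\<^sup>2 / 4 * (2 * v + 5 - (v + 2) * (b\<^sup>2 / (1 + b\<^sup>2))) * b * sqrt (v + 1) * student_const (v + 1) * r"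
    unfolding i by (simp add: field_simps power2_eq_square)
  finally show ?thesis by (simp add: r_def)
qed

text \<open>
  The elasticity $w t_{v+1}(w) / T_{v+1}(w)$ of the skewing factor at its limiting argument
  $w = b \sqrt{v+1}$. It measures how the skewing deforms the shape of the tail and vanishes for
  $b = 0$.
\<close>

definition skew_ratio :: "real \<Rightarrow> real \<Rightarrow> real" where
  "skew_ratio v b = student_const (v + 1) * sqrt (v + 1) * b * (1 + b\<^sup>2) powr (- ((v + 2) / 2))
     / student_cdf (v + 1) (b * sqrt (v + 1))"

definition tail_const :: "real \<Rightarrow> real \<Rightarrow> real" where
  "tail_const v b = 2 * student_const v * v powr ((v - 1) / 2) * student_cdf (v + 1) (b * sqrt (v + 1))"

text \<open>
  The coefficients of the tail relative to its leading power: the Taylor coefficients of the kernel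
  divided by its value at $0$, times the factors $v/(v+2)$ and $v/(v+4)$ that come from
  integrating $y^{-v-1-2j}$.
\<close>

definition tail_coeff1 :: "real \<Rightarrow> real \<Rightarrow> real" where
  "tail_coeff1 v b = - (v\<^sup>2 / (2 * (v + 2))) * (v + 1 + skew_ratio v b)"

definition tail_coeff2 :: "real \<Rightarrow> real \<Rightarrow> real" where
  "tail_coeff2 v b = v ^ 3 / (8 * (v + 4))
     * ((v + 1) * (v + 3) + skew_ratio v b * (2 * v + 5 - (v + 2) * b\<^sup>2 / (1 + b\<^sup>2)))"

lemma tail_const_pos: "v > 0 \<Longrightarrow> tail_const v b > 0"
  unfolding tail_const_def by (intro mult_pos_pos student_const_pos student_cdf_pos) auto

text \<open>
  The difference vanishes at infinity, so it suffices to compare derivatives. After multiplication by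
  $y^{v+5}$ the derivative is a constant times the remainder of the second-order Taylor formula
  of the kernel at $s = y^{-2}$, divided by $s^2$.
\<close>

lemma skew_t_tail_expansion:
  assumes v: "v > 0"
  shows "((\<lambda>y. y powr (v + 4) * (1 - skew_t_cdf v b y - tail_const v b *
           (y powr (- v) + tail_coeff1 v b * y powr (- (v + 2)) + tail_coeff2 v b * y powr (- (v + 4)))))
         \<longlongrightarrow> 0) at_top"
proof (rule powr_tail_from_derivative)
  let ?K = "tail_const v b" and ?c1 = "tail_coeff1 v b" and ?c2 = "tail_coeff2 v b"
  let ?D' = "\<lambda>y. - skew_t_pdf v b y + ?K * (v * y powr (- (v + 1)) + (v + 2) * ?c1 * y powr (- (v + 3))
      + (v + 4) * ?c2 * y powr (- (v + 5)))"
  show "v + 4 > 0" using v by simp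
  show "((\<lambda>y. 1 - skew_t_cdf v b y - ?K *
           (y powr (- v) + ?c1 * y powr (- (v + 2)) + ?c2 * y powr (- (v + 4))))
      has_real_derivative ?D' y) (at y)" if "y > 0" for y
  proof -
    have e: "- v - 1 = - (v + 1)" "- (v + 2) - 1 = - (v + 3)" "- (v + 4) - 1 = - (v + 5)" by simp_all
    have d: "((\<lambda>y. y powr a) has_real_derivative a * y powr (a - 1)) (at y)" for a
      using that by (auto intro!: derivative_eq_intros)
    have "((\<lambda>y. 1 - skew_t_cdf v b y - ?K *
           (y powr (- v) + ?c1 * y powr (- (v + 2)) + ?c2 * y powr (- (v + 4))))
      has_real_derivative 0 - skew_t_pdf v b y - ?K * ((- v) * y powr (- v - 1)
         + ?c1 * (- (v + 2) * y powr (- (v + 2) - 1)) + ?c2 * (- (v + 4) * y powr (- (v + 4) - 1)))) (at y)"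
      by (intro DERIV_diff DERIV_add DERIV_cmult d DERIV_const skew_t_cdf_has_derivative v)
    thus ?thesis
      unfolding e by (rule DERIV_cong) (simp add: algebra_simps)
  qed
  have 0: "((\<lambda>y. y powr (- a)) \<longlongrightarrow> 0) at_top" if "a > 0" for a :: real
    using that by (intro tendsto_neg_powr filterlim_ident) auto
  have "((\<lambda>y. 1 - skew_t_cdf v b y - ?K *
           (y powr (- v) + ?c1 * y powr (- (v + 2)) + ?c2 * y powr (- (v + 4))))
      \<longlongrightarrow> 1 - 1 - ?K * (0 + ?c1 * 0 + ?c2 * 0)) at_top"
    using v by (intro tendsto_intros 0 skew_t_cdf_tendsto_1) auto
  thus "((\<lambda>y. 1 - skew_t_cdf v b y - ?K *
           (y powr (- v) + ?c1 * y powr (- (v + 2)) + ?c2 * y powr (- (v + 4)))) \<longlongrightarrow> 0) at_top"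
    by simp
  define T0 where "T0 = student_cdf (v + 1) (b * sqrt (v + 1))"
  have T0: "T0 > 0" unfolding T0_def using v by (intro student_cdf_pos) auto
  define M where "M = 2 * student_const v * v powr ((v + 1) / 2)"
  define c where "c = v\<^sup>2 * (v + 1) * (v + 3) / 4 * T0
      + v\<^sup>2 / 4 * (2 * v + 5 - (v + 2) * b\<^sup>2 / (1 + b\<^sup>2)) * b * sqrt (v + 1) * student_const (v + 1)
        * (1 + b\<^sup>2) powr (- ((v + 2) / 2))"
  let ?h = "skew_kernel v b" and ?h' = "skew_kernel_deriv v b"
  have \<rho>: "student_const (v + 1) * sqrt (v + 1) * b * (1 + b\<^sup>2) powr (- ((v + 2) / 2)) = T0 * skew_ratio v b"
    using T0 by (simp add: skew_ratio_def T0_def)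
  have h0: "?h 0 = T0" by (simp add: skew_kernel_def T0_def)
  have "?h' 0 = - (v * (v + 1) / 2) * T0
       - v / 2 * (student_const (v + 1) * sqrt (v + 1) * b * (1 + b\<^sup>2) powr (- ((v + 2) / 2)))"
    by (simp add: skew_kernel_deriv_def T0_def)
  hence h'0: "?h' 0 = - (v / 2) * T0 * (v + 1 + skew_ratio v b)"
    unfolding \<rho> by (simp add: field_simps)
  define E where "E = 2 * v + 5 - (v + 2) * b\<^sup>2 / (1 + b\<^sup>2)"
  have "c = v\<^sup>2 * (v + 1) * (v + 3) / 4 * T0
      + v\<^sup>2 / 4 * E * (student_const (v + 1) * sqrt (v + 1) * b * (1 + b\<^sup>2) powr (- ((v + 2) / 2)))"
    by (simp add: c_def E_def mult_ac)
  hence c: "c = v\<^sup>2 / 4 * T0 * ((v + 1) * (v + 3) + skew_ratio v b * E)"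
    unfolding \<rho> by (simp add: field_simps)
  have "v powr ((v + 1) / 2) = v * v powr ((v - 1) / 2)"
    using v powr_mult_base[of v "(v - 1) / 2"] by (simp add: field_simps)
  hence Kv: "?K * v = M * T0"
    by (simp add: tail_const_def M_def T0_def)
  \<comment> \<open>The coefficients are chosen so that the derivative reproduces the Taylor polynomial of the kernel.\<close>
  have m1: "?K * ((v + 2) * ?c1) = M * ?h' 0"
  proof -
    have "(v + 2) * ?c1 = v * (- (v / 2) * (v + 1 + skew_ratio v b))"
      using v by (simp add: tail_coeff1_def divide_simps power2_eq_square) (simp add: algebra_simps)
    hence "?K * ((v + 2) * ?c1) = (?K * v) * (- (v / 2) * (v + 1 + skew_ratio v b))" by simp
    thus ?thesis unfolding Kv h'0 by simp
  qed
  have m2: "?K * ((v + 4) * ?c2) = M * (c / 2)"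
  proof -
    define X where "X = (v + 1) * (v + 3) + skew_ratio v b * E"
    have "(v + 4) * ?c2 = v * (v\<^sup>2 / 8 * X)"
      using v unfolding tail_coeff2_def E_def[symmetric] X_def[symmetric] by (simp add: divide_simps power2_eq_square power3_eq_cube)
    hence "?K * ((v + 4) * ?c2) = (?K * v) * (v\<^sup>2 / 8 * X)" by simp
    thus ?thesis unfolding Kv c X_def[symmetric] by simp
  qed
  have "((\<lambda>s. (?h s - ?h 0 - ?h' 0 * s - c / 2 * s\<^sup>2) / s\<^sup>2) \<longlongrightarrow> 0) (at_right 0)"
    using v unfolding c_def T0_def
    by (intro taylor2_at_right_0 skew_kernel_has_derivative skew_kernel_deriv_has_derivative_at_0)
  moreover have "filterlim (\<lambda>y::real. y powr (- 2)) (at_right 0) at_top"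
    by real_asymp
  ultimately have "((\<lambda>y. (?h (y powr (- 2)) - ?h 0 - ?h' 0 * y powr (- 2) - c / 2 * (y powr (- 2))\<^sup>2) / (y powr (- 2))\<^sup>2)
      \<longlongrightarrow> 0) at_top"
    by (rule filterlim_compose)
  from tendsto_mult[OF tendsto_const[of "- M"] this]
  have "((\<lambda>y. - M * ((?h (y powr (- 2)) - ?h 0 - ?h' 0 * y powr (- 2) - c / 2 * (y powr (- 2))\<^sup>2) / (y powr (- 2))\<^sup>2))
      \<longlongrightarrow> 0) at_top" by simp
  thus "((\<lambda>y. y powr (v + 4 + 1) * ?D' y) \<longlongrightarrow> 0) at_top"
  proof (rule Lim_transform_eventually)
    show "\<forall>\<^sub>F y in at_top. - M * ((?h (y powr (- 2)) - ?h 0 - ?h' 0 * y powr (- 2) - c / 2 * (y powr (- 2))\<^sup>2) / (y powr (- 2))\<^sup>2)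
        = y powr (v + 4 + 1) * ?D' y"
      using eventually_gt_at_top[of 0]
    proof eventually_elim
      case (elim y)
      define s where "s = y powr (- 2)"
      have s2: "s\<^sup>2 = y powr (- 4)"
        using elim by (simp add: s_def power2_eq_square flip: powr_add)
      have e: "- (v + 3) = - (v + 1) + - 2" "- (v + 5) = - (v + 1) + - 4" "v + 4 + 1 = 4 + (v + 1)"
        by simp_all
      have p3: "y powr (- (v + 3)) = y powr (- (v + 1)) * s" unfolding e(1) s_def by (rule powr_add)
      have p5: "y powr (- (v + 5)) = y powr (- (v + 1)) * s\<^sup>2" unfolding e(2) s2 by (rule powr_add)
      have y5: "y powr (v + 4 + 1) * y powr (- (v + 1)) = 1 / s\<^sup>2"
        unfolding s2 by (simp add: powr_minus_divide flip: powr_add)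
      have "?D' y = y powr (- (v + 1)) * (- M * ?h s + ?K * v + ?K * ((v + 2) * ?c1) * s + ?K * ((v + 4) * ?c2) * s\<^sup>2)"
        unfolding skew_t_pdf_eq_kernel[OF v elim] M_def[symmetric] s_def[symmetric] p3 p5 by (simp add: algebra_simps)
      also have "\<dots> = y powr (- (v + 1)) * (- M * (?h s - ?h 0 - ?h' 0 * s - c / 2 * s\<^sup>2))"
        unfolding Kv m1 m2 h0 by (simp add: algebra_simps)
      finally have "y powr (v + 4 + 1) * ?D' y = (y powr (v + 4 + 1) * y powr (- (v + 1))) * (- M * (?h s - ?h 0 - ?h' 0 * s - c / 2 * s\<^sup>2))"
        by (simp only: mult.assoc)
      thus ?case unfolding y5 s_def[symmetric] by simp
    qed
  qed
qed

text \<open>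
  The constants of the result are the tail coefficients of the first components and the ratios
  of their tail constants.
\<close>

lemma kappa_eq_tail_const: "kappa v \<beta> p = p 1 * tail_const (v 1) (\<beta> 1) / 2"
  by (simp add: kappa_def tail_const_def)

lemma A1_eq_tail_coeff1:
  assumes "v 1 > 0"
  shows "A1 v \<beta> = tail_coeff1 (v 1) (\<beta> 1)"
proof -
  have "student_cdf (v 1 + 1) (\<beta> 1 * sqrt (v 1 + 1)) > 0"
    using assms by (intro student_cdf_pos) auto
  thus ?thesis
    using assms by (simp add: A1_def tail_coeff1_def skew_ratio_def divide_simps) (simp add: algebra_simps)
qed

text \<open>
  The two brackets are in partial fractions; over the common denominator $8 (v+2) (v+4)$ a
  factor $v + 2$ cancels in each of them.
\<close>

lemma A2_eq_tail_coeff2: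
  assumes "v 1 > 0"
  shows "A2 v \<beta> = tail_coeff2 (v 1) (\<beta> 1)"
proof -
  define w b where "w = v 1" and "b = \<beta> 1"
  have nz: "w + 2 \<noteq> 0" "w + 4 \<noteq> 0" "1 + b\<^sup>2 \<noteq> 0"
    using assms zero_le_power2[of b] unfolding w_def by linarith+
  define i where "i = b\<^sup>2 / (1 + b\<^sup>2)"
  have i: "(w + 2) * b\<^sup>2 * w ^ 3 / (8 * (w + 4) * (1 + b\<^sup>2)) = (w + 2) * i * w ^ 3 / (8 * (w + 4))"
          "2 * w + 5 - (w + 2) * b\<^sup>2 / (1 + b\<^sup>2) = 2 * w + 5 - (w + 2) * i"
    by (simp_all add: i_def)
  have skewed: "w ^ 3 * (w - 1) / (4 * (w + 2)) + 3 * w\<^sup>2 / 8 - 3 * w\<^sup>2 / ((w + 2) * (w + 4))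
         - (w + 2) * i * w ^ 3 / (8 * (w + 4)) = w ^ 3 / (8 * (w + 4)) * (2 * w + 5 - (w + 2) * i)"
    using nz by (simp add: divide_simps) algebra
  have symmetric: "w\<^sup>2 * (w\<^sup>2 - 1) / 8 + 3 * w\<^sup>2 / ((w + 2) * (w + 4)) + w\<^sup>2 * (w - 1) / (2 * (w + 2))
     = w ^ 3 / (8 * (w + 4)) * ((w + 1) * (w + 3))"
    using nz by (simp add: divide_simps) algebra
  have "A2 v \<beta> = skew_ratio w b * (w ^ 3 * (w - 1) / (4 * (w + 2)) + 3 * w\<^sup>2 / 8 - 3 * w\<^sup>2 / ((w + 2) * (w + 4))
         - (w + 2) * b\<^sup>2 * w ^ 3 / (8 * (w + 4) * (1 + b\<^sup>2)))
      + (w\<^sup>2 * (w\<^sup>2 - 1) / 8 + 3 * w\<^sup>2 / ((w + 2) * (w + 4)) + w\<^sup>2 * (w - 1) / (2 * (w + 2)))"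
    unfolding A2_def skew_ratio_def w_def b_def by simp
  also have "\<dots> = tail_coeff2 w b"
  proof -
    have "\<rho> * (X * Y) + X * Z = X * (Z + \<rho> * Y)" for \<rho> X Y Z :: real
      by (simp add: algebra_simps)
    thus ?thesis unfolding tail_coeff2_def i skewed symmetric .
  qed
  finally show ?thesis by (simp add: w_def b_def)
qed

lemma A3_eq_tail_ratio: "A3 v \<beta> p = p 2 * tail_const (v 2) (\<beta> 2) / (p 1 * tail_const (v 1) (\<beta> 1))"
  by (simp add: A3_def tail_const_def)

lemma A4_eq_tail_coeff1:
  assumes "v 2 > 0"
  shows "A4 v \<beta> p = A3 v \<beta> p * tail_coeff1 (v 2) (\<beta> 2)"
proof -
  have "student_cdf (v 2 + 1) (\<beta> 2 * sqrt (v 2 + 1)) > 0"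
    using assms by (intro student_cdf_pos) auto
  hence "student_const (v 2 + 1) * (v 2)\<^sup>2 * sqrt (v 2 + 1) * \<beta> 2 * (1 + (\<beta> 2)\<^sup>2) powr (- ((v 2 + 2) / 2))
        / (2 * (v 2 + 2) * student_cdf (v 2 + 1) (\<beta> 2 * sqrt (v 2 + 1)))
       + (v 2)\<^sup>2 * (v 2 + 1) / (2 * (v 2 + 2)) = - tail_coeff1 (v 2) (\<beta> 2)"
    using assms by (simp add: tail_coeff1_def skew_ratio_def divide_simps) (simp add: algebra_simps)
  thus ?thesis unfolding A4_def by simp
qed

lemma A5_eq_tail_ratio: "A5 v \<beta> p = p 3 * tail_const (v 3) (\<beta> 3) / (p 1 * tail_const (v 1) (\<beta> 1))"
  by (simp add: A5_def tail_const_def)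

section \<open>Finite sums of real powers\<close>

text \<open>
  Linear combinations of powers $y^{-e}$ are kept as lists of pairs (coefficient, exponent), since
  different entries may have the same exponent for particular parameters; \<open>coeff_at\<close>
  collects the total coefficient of such an exponent.
\<close>

definition power_sum :: "(real \<times> real) list \<Rightarrow> real \<Rightarrow> real" where
  "power_sum L y = (\<Sum>(c, e)\<leftarrow>L. c * y powr (- e))"

definition coeff_at :: "(real \<times> real) list \<Rightarrow> real \<Rightarrow> real" where
  "coeff_at L t = (\<Sum>(c, e)\<leftarrow>L. of_bool (e = t) * c)"

lemma power_sum_simps [simp]:
  "power_sum [] y = 0" "power_sum ((c, e) # L) y = c * y powr (- e) + power_sum L y"
  by (simp_all add: power_sum_def)

lemma power_sum_append [simp]: "power_sum (L @ L') y = power_sum L y + power_sum L' y"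
  by (induction L) auto

lemma coeff_at_simps [simp]:
  "coeff_at [] t = 0" "coeff_at ((c, e) # L) t = of_bool (e = t) * c + coeff_at L t"
  by (simp_all add: coeff_at_def)

lemma coeff_at_append [simp]: "coeff_at (L @ L') t = coeff_at L t + coeff_at L' t"
  by (induction L) auto

lemma powr_tendsto_of_bool:
  assumes "e \<ge> (m :: real)"
  shows "((\<lambda>y. y powr m * y powr (- e)) \<longlongrightarrow> of_bool (e = m)) at_top"
proof (cases "e = m")
  case True
  have "\<forall>\<^sub>F y in at_top. 1 = y powr m * y powr (- e)"
    using eventually_gt_at_top[of 0] by eventually_elim (simp add: True powr_minus)
  thus ?thesis using True by (auto intro: Lim_transform_eventually[OF tendsto_const])
next
  case False
  have "((\<lambda>y. y powr (m - e)) \<longlongrightarrow> 0) at_top"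
    using False assms by (intro tendsto_neg_powr filterlim_ident) auto
  thus ?thesis using False by (simp flip: powr_add)
qed

lemma power_sum_tendsto:
  assumes "\<forall>(c, e)\<in>set L. e \<ge> m"
  shows "((\<lambda>y. y powr m * power_sum L y) \<longlongrightarrow> coeff_at L m) at_top"
  using assms
proof (induction L)
  case (Cons t L)
  obtain c e where t: "t = (c, e)" by (cases t)
  have "((\<lambda>y. c * (y powr m * y powr (- e)) + y powr m * power_sum L y)
          \<longlongrightarrow> c * of_bool (e = m) + coeff_at L m) at_top"
    using Cons by (intro tendsto_intros powr_tendsto_of_bool) (auto simp: t)
  thus ?case by (simp add: t algebra_simps)
qed simp

text \<open>
  If $\theta$ is separated from all other exponents by a gap up to $m$, the terms with exponent
  $\theta$ cancel and every other term, multiplied by $y^m$, tends to its coefficient or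
  to $0$.
\<close>

lemma power_sum_two_terms:
  assumes "\<theta> < m" "\<forall>(c, e)\<in>set L. e = \<theta> \<or> e \<ge> m"
  shows "((\<lambda>y. y powr m * (power_sum L y - coeff_at L \<theta> * y powr (- \<theta>))) \<longlongrightarrow> coeff_at L m) at_top"
  using assms(2)
proof (induction L)
  case (Cons t L)
  obtain c e where t: "t = (c, e)" by (cases t)
  let ?rest = "\<lambda>y. y powr m * (power_sum L y - coeff_at L \<theta> * y powr (- \<theta>))"
  have IH: "(?rest \<longlongrightarrow> coeff_at L m) at_top" using Cons by auto
  show ?case
  proof (cases "e = \<theta>")
    case True
    have "(\<lambda>y. y powr m * (power_sum (t # L) y - coeff_at (t # L) \<theta> * y powr (- \<theta>))) = ?rest"
      by (simp add: t True algebra_simps)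
    thus ?thesis using IH True assms(1) by (simp add: t)
  next
    case False
    have "((\<lambda>y. c * (y powr m * y powr (- e)) + ?rest y) \<longlongrightarrow> c * of_bool (e = m) + coeff_at L m) at_top"
      using Cons.prems False IH by (intro tendsto_intros powr_tendsto_of_bool) (auto simp: t)
    thus ?thesis using False by (simp add: t algebra_simps)
  qed
qed simp

section \<open>The tail of the mixture\<close>

text \<open>
  The expansions below concern one fixed mixture. The bound $m$ always stands for the order up to
  which terms are resolved: errors are shown to be $o(y^{-m})$.
\<close>

locale skew_t_mixture =
  fixes r :: nat and v \<beta> p :: "nat \<Rightarrow> real"
  assumes r: "r \<ge> 1" and v1_pos: "0 < v 1" and v_mono: "strict_mono_on {1..r} v"
    and p_pos: "\<forall>i\<in>{1..r}. p i > 0" and p_sum: "(\<Sum>i = 1..r. p i) = 1"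
begin

abbreviation "F \<equiv> mstd_cdf r v \<beta> p"
abbreviation "\<kappa> \<equiv> kappa v \<beta> p"

lemma v_less: "i \<in> {1..r} \<Longrightarrow> j \<in> {1..r} \<Longrightarrow> i < j \<Longrightarrow> v i < v j"
  using v_mono by (auto simp: strict_mono_on_def)

lemma v_pos: "i \<in> {1..r} \<Longrightarrow> v i > 0"
  using v_less[of 1 i] v1_pos r by (cases "i = 1") auto

lemma kappa_pos: "\<kappa> > 0"
  unfolding kappa_eq_tail_const using p_pos r v1_pos by (auto intro!: mult_pos_pos tail_const_pos)

definition weight :: "nat \<Rightarrow> real" where
  "weight i = p i * tail_const (v i) (\<beta> i) / (2 * \<kappa>)"

lemma weight_simps: "weight 1 = 1" "weight (Suc 0) = 1" "weight 2 = A3 v \<beta> p" "weight 3 = A5 v \<beta> p"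
proof -
  have "p 1 \<noteq> 0" "tail_const (v 1) (\<beta> 1) \<noteq> 0"
    using p_pos r tail_const_pos[OF v1_pos, of "\<beta> 1"] by force+
  thus "weight 1 = 1" "weight (Suc 0) = 1" "weight 2 = A3 v \<beta> p" "weight 3 = A5 v \<beta> p"
    by (simp_all add: weight_def kappa_eq_tail_const A3_eq_tail_ratio A5_eq_tail_ratio)
qed

definition component_tail :: "nat \<Rightarrow> real \<Rightarrow> real" where
  "component_tail i y = p i * (1 - skew_t_cdf (v i) (\<beta> i) y) * y powr (v 1) / (2 * \<kappa>)"

text \<open>
  Dividing by the leading tail $2 \kappa y^{-v_1}$ of the mixture turns the expansion of one
  component into one in the relative exponents $v_i - v_1 + 2 j$.
\<close>

lemma component_tail_expansion:
  assumes i: "i \<in> {1..r}" and m: "m \<le> v i - v 1 + 4"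
  shows "((\<lambda>y. y powr m * (component_tail i y - weight i * (y powr (- (v i - v 1))
            + tail_coeff1 (v i) (\<beta> i) * y powr (- (v i - v 1 + 2))
            + tail_coeff2 (v i) (\<beta> i) * y powr (- (v i - v 1 + 4))))) \<longlongrightarrow> 0) at_top"
proof -
  let ?c1 = "tail_coeff1 (v i) (\<beta> i)" and ?c2 = "tail_coeff2 (v i) (\<beta> i)" and ?K = "tail_const (v i) (\<beta> i)"
  let ?T = "\<lambda>y. y powr (v i + 4) * (1 - skew_t_cdf (v i) (\<beta> i) y - ?K *
           (y powr (- v i) + ?c1 * y powr (- (v i + 2)) + ?c2 * y powr (- (v i + 4))))"
  have "((\<lambda>y. p i / (2 * \<kappa>) * (y powr m * y powr (- (v i - v 1 + 4))) * ?T y)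
      \<longlongrightarrow> p i / (2 * \<kappa>) * of_bool (v i - v 1 + 4 = m) * 0) at_top"
    by (intro tendsto_intros skew_t_tail_expansion v_pos i powr_tendsto_of_bool m)
  hence "((\<lambda>y. p i / (2 * \<kappa>) * (y powr m * y powr (- (v i - v 1 + 4))) * ?T y) \<longlongrightarrow> 0) at_top"
    by simp
  thus ?thesis
  proof (rule Lim_transform_eventually)
    show "\<forall>\<^sub>F y in at_top. p i / (2 * \<kappa>) * (y powr m * y powr (- (v i - v 1 + 4))) * ?T y
      = y powr m * (component_tail i y - weight i * (y powr (- (v i - v 1))
            + ?c1 * y powr (- (v i - v 1 + 2)) + ?c2 * y powr (- (v i - v 1 + 4))))"
      using eventually_gt_at_top[of 0]
    proof eventually_elim
      case (elim y)
      have shift: "y powr (- (v i - v 1 + 4)) * y powr (v i + 4) = y powr (v 1)"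
        by (simp flip: powr_add)
      have sh: "y powr (- (v i - v 1 + a)) = y powr (v 1) * y powr (- (v i + a))" for a
        by (simp add: algebra_simps flip: powr_add)
      have sh0: "y powr (- (v i - v 1)) = y powr (v 1) * y powr (- v i)"
        by (simp flip: powr_add)
      have "p i / (2 * \<kappa>) * (y powr m * y powr (- (v i - v 1 + 4))) * ?T y
         = p i / (2 * \<kappa>) * y powr m * (y powr (- (v i - v 1 + 4)) * y powr (v i + 4))
           * (1 - skew_t_cdf (v i) (\<beta> i) y - ?K *
           (y powr (- v i) + ?c1 * y powr (- (v i + 2)) + ?c2 * y powr (- (v i + 4))))"
        by (simp only: mult_ac)
      also have "\<dots> = y powr m * (component_tail i y - weight i * (y powr (- (v i - v 1))
            + ?c1 * y powr (- (v i - v 1 + 2)) + ?c2 * y powr (- (v i - v 1 + 4))))"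
        unfolding shift unfolding sh sh0 component_tail_def weight_def using kappa_pos by (simp add: field_simps)
      finally show ?case .
    qed
  qed
qed

text \<open>
  The relative deviation of the tail of the mixture from its leading power
  $2 \kappa y^{-v_1}$.
\<close>

definition tail_dev :: "real \<Rightarrow> real" where
  "tail_dev y = (1 - F y) * y powr (v 1) / (2 * \<kappa>) - 1"

text \<open>
  Under the bounds on $m$ in \<open>tail_dev_expansion\<close> these terms suffice: the first component
  needs both corrections, the second one only its first, the third one none, and the later
  components decay faster than $y^{-m}$.
\<close>

definition tail_dev_terms :: "(real \<times> real) list" where
  "tail_dev_terms = [(A1 v \<beta>, 2), (A2 v \<beta>, 4)]
     @ (if 2 \<le> r then [(A3 v \<beta> p, v 2 - v 1), (A4 v \<beta> p, v 2 - v 1 + 2)] else [])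
     @ (if 3 \<le> r then [(A5 v \<beta> p, v 3 - v 1)] else [])"

lemma tail_dev_eq: "tail_dev y = (\<Sum>i = 1..r. component_tail i y) - 1"
proof -
  have "1 - F y = (\<Sum>i = 1..r. p i * (1 - skew_t_cdf (v i) (\<beta> i) y))"
    using p_sum by (simp add: mstd_cdf_def sum_subtractf right_diff_distrib)
  thus ?thesis
    by (simp add: tail_dev_def component_tail_def sum_distrib_right sum_divide_distrib)
qed

lemma tail_dev_expansion:
  assumes m4: "m \<le> 4" and m2: "2 \<le> r \<Longrightarrow> m \<le> v 2 - v 1 + 2" and m3: "3 \<le> r \<Longrightarrow> m \<le> v 3 - v 1"
  shows "((\<lambda>y. y powr m * (tail_dev y - power_sum tail_dev_terms y)) \<longlongrightarrow> 0) at_top"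
proof -
  define g where "g i y = (if i = 1 then 1 + A1 v \<beta> * y powr (- 2) + A2 v \<beta> * y powr (- 4)
     else if i = 2 then A3 v \<beta> p * y powr (- (v 2 - v 1)) + A4 v \<beta> p * y powr (- (v 2 - v 1 + 2))
     else if i = 3 then A5 v \<beta> p * y powr (- (v 3 - v 1)) else 0)" for i :: nat and y :: real
  have small: "((\<lambda>y. y powr m * y powr (- e)) \<longlongrightarrow> 0) at_top" if "e > m" for e
    using powr_tendsto_of_bool[of m e] that by simp
  have comp: "((\<lambda>y. y powr m * (component_tail i y - g i y)) \<longlongrightarrow> 0) at_top" if i: "i \<in> {1..r}" for i
  proof -
    let ?c1 = "tail_coeff1 (v i) (\<beta> i)" and ?c2 = "tail_coeff2 (v i) (\<beta> i)"
    let ?d = "v i - v 1"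
    have d: "?d \<ge> 0" using v_less[of 1 i] i by (cases "i = 1") auto
    have ex: "((\<lambda>y. y powr m * (component_tail i y - weight i * (y powr (- ?d)
            + ?c1 * y powr (- (?d + 2)) + ?c2 * y powr (- (?d + 4))))) \<longlongrightarrow> 0) at_top"
      using m4 d by (intro component_tail_expansion i) auto
    consider "i = 1" | "i = 2" | "i = 3" | "i > 3" using i by (cases "i = 0") force+
    thus ?thesis
    proof cases
      case 1
      have "\<forall>\<^sub>F y in at_top. y powr m * (component_tail i y - weight i * (y powr (- ?d)
            + ?c1 * y powr (- (?d + 2)) + ?c2 * y powr (- (?d + 4)))) = y powr m * (component_tail i y - g i y)"
        using eventually_gt_at_top[of 0]
        by eventually_elim (simp add: 1 g_def weight_simps A1_eq_tail_coeff1[of v \<beta>, OF v1_pos] A2_eq_tail_coeff2[of v \<beta>, OF v1_pos])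
      thus ?thesis by (rule Lim_transform_eventually[OF ex])
    next
      case 2
      have v2: "v 2 > v 1" "v 2 > 0" using i v_less[of 1 2] v1_pos 2 by auto
      have "((\<lambda>y. y powr m * (component_tail i y - weight i * (y powr (- ?d)
            + ?c1 * y powr (- (?d + 2)) + ?c2 * y powr (- (?d + 4))))
         + weight i * ?c2 * (y powr m * y powr (- (?d + 4)))) \<longlongrightarrow> 0 + weight i * ?c2 * 0) at_top"
        using m4 v2 2 by (intro tendsto_intros ex small) auto
      moreover have "(\<lambda>y. y powr m * (component_tail i y - weight i * (y powr (- ?d)
            + ?c1 * y powr (- (?d + 2)) + ?c2 * y powr (- (?d + 4))))
         + weight i * ?c2 * (y powr m * y powr (- (?d + 4)))) = (\<lambda>y. y powr m * (component_tail i y - g i y))"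
        using v2 by (simp add: 2 g_def weight_simps A4_eq_tail_coeff1 algebra_simps)
      ultimately show ?thesis by simp
    next
      case 3
      have v3: "v 3 > v 1" using i v_less[of 1 3] 3 by auto
      have m3': "m \<le> v 3 - v 1" using m3 i 3 by auto
      have "((\<lambda>y. y powr m * (component_tail i y - weight i * (y powr (- ?d)
            + ?c1 * y powr (- (?d + 2)) + ?c2 * y powr (- (?d + 4))))
         + weight i * ?c1 * (y powr m * y powr (- (?d + 2)))
         + weight i * ?c2 * (y powr m * y powr (- (?d + 4)))) \<longlongrightarrow> 0 + weight i * ?c1 * 0 + weight i * ?c2 * 0) at_top"
        using m3' v3 3 by (intro tendsto_intros ex small) auto
      moreover have "(\<lambda>y. y powr m * (component_tail i y - weight i * (y powr (- ?d)
            + ?c1 * y powr (- (?d + 2)) + ?c2 * y powr (- (?d + 4))))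
         + weight i * ?c1 * (y powr m * y powr (- (?d + 2)))
         + weight i * ?c2 * (y powr m * y powr (- (?d + 4)))) = (\<lambda>y. y powr m * (component_tail i y - g i y))"
        by (simp add: 3 g_def weight_simps algebra_simps)
      ultimately show ?thesis by simp
    next
      case 4
      have "v 3 < v i" "m \<le> v 3 - v 1" using i v_less[of 3 i] m3 4 by auto
      hence di: "?d > m" by linarith
      have "((\<lambda>y. y powr m * (component_tail i y - weight i * (y powr (- ?d)
            + ?c1 * y powr (- (?d + 2)) + ?c2 * y powr (- (?d + 4))))
         + weight i * (y powr m * y powr (- ?d))
         + weight i * ?c1 * (y powr m * y powr (- (?d + 2)))
         + weight i * ?c2 * (y powr m * y powr (- (?d + 4)))) 
         \<longlongrightarrow> 0 + weight i * 0 + weight i * ?c1 * 0 + weight i * ?c2 * 0) at_top"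
        using di by (intro tendsto_intros ex small) auto
      moreover have "(\<lambda>y. y powr m * (component_tail i y - weight i * (y powr (- ?d)
            + ?c1 * y powr (- (?d + 2)) + ?c2 * y powr (- (?d + 4))))
         + weight i * (y powr m * y powr (- ?d))
         + weight i * ?c1 * (y powr m * y powr (- (?d + 2)))
         + weight i * ?c2 * (y powr m * y powr (- (?d + 4)))) = (\<lambda>y. y powr m * (component_tail i y - g i y))"
        using 4 by (simp add: g_def algebra_simps)
      ultimately show ?thesis by simp
    qed
  qed
  \<comment> \<open>The constant $1$ in the share of the first component is the one subtracted in \<open>tail_dev\<close>.\<close>
  have g_sum: "(\<Sum>i = 1..r. g i y) = 1 + power_sum tail_dev_terms y" for y
  proof -
    \<comment> \<open>Only the first three components have terms, and some of these three may be absent.\<close>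
    have "(\<Sum>i = 1..r. g i y) = (\<Sum>i \<in> {1..min r 3}. g i y)"
      by (rule sum.mono_neutral_right) (auto simp: g_def)
    also have "min r 3 = 1 \<or> min r 3 = 2 \<or> min r 3 = 3" using r by linarith
    hence "(\<Sum>i \<in> {1..min r 3}. g i y) = g 1 y + (if 2 \<le> r then g 2 y else 0) + (if 3 \<le> r then g 3 y else 0)"
      by (auto simp: numeral_eq_Suc min_def split: if_splits)
    also have "\<dots> = 1 + power_sum tail_dev_terms y"
      by (simp add: g_def tail_dev_terms_def)
    finally show ?thesis .
  qed
  have "((\<lambda>y. \<Sum>i = 1..r. y powr m * (component_tail i y - g i y)) \<longlongrightarrow> (\<Sum>i = 1..r. 0)) at_top"
    by (intro tendsto_sum comp)
  moreover have "(\<Sum>i = 1..r. y powr m * (component_tail i y - g i y)) = y powr m * (tail_dev y - power_sum tail_dev_terms y)" for y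
    unfolding sum_distrib_left[symmetric] sum_subtractf g_sum tail_dev_eq by simp
  ultimately show ?thesis by simp
qed

section \<open>The logarithm of the mixture distribution function\<close>

text \<open>
  The relative deviation of $- \ln F$ from $2 \kappa y^{-v_1}$; this is the function whose
  expansion governs the powers of $F$.
\<close>

definition log_dev :: "real \<Rightarrow> real" where
  "log_dev y = - ln (F y) * y powr (v 1) / (2 * \<kappa>) - 1"

text \<open>
  The terms of $u + u^2/2 + u^3/3$, where $u = w (1 + \varepsilon)$ is the tail,
  $w = 2 \kappa y^{-v_1}$ and $\varepsilon$ stands for \<open>tail_dev\<close>: dividing by $w$ and
  subtracting $1$ gives $\varepsilon + w/2 + w \varepsilon + w^2/3$ up to negligible terms, and
  of $\varepsilon$ only the terms with exponents $2$ and $v_2 - v_1$ remain visible in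
  $w \varepsilon$.
\<close>

definition log_dev_terms :: "(real \<times> real) list" where
  "log_dev_terms = tail_dev_terms @ [(\<kappa>, v 1), (2 * \<kappa> * A1 v \<beta>, v 1 + 2), (4 / 3 * \<kappa>\<^sup>2, 2 * v 1)]
     @ (if 2 \<le> r then [(2 * \<kappa> * A3 v \<beta> p, v 2)] else [])"

lemma tail_tendsto_0: "((\<lambda>y. 1 - F y) \<longlongrightarrow> 0) at_top"
proof -
  have "((\<lambda>y. \<Sum>i = 1..r. p i * skew_t_cdf (v i) (\<beta> i) y) \<longlongrightarrow> (\<Sum>i = 1..r. p i * 1)) at_top"
    by (intro tendsto_intros skew_t_cdf_tendsto_1 v_pos)
  hence "(F \<longlongrightarrow> 1) at_top"
    unfolding mstd_cdf_def using p_sum by simp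
  from tendsto_diff[OF tendsto_const[of 1] this] show ?thesis by simp
qed

text \<open>
  The quotient extends continuously by the value $0$ to $u = 0$, and this is also its value there
  because of division by zero. The limit can therefore be taken along the tail even where it
  vanishes.
\<close>

lemma log_remainder_tendsto_0:
  "((\<lambda>y. (- ln (F y) - (1 - F y) - (1 - F y)\<^sup>2 / 2 - (1 - F y) ^ 3 / 3) / (1 - F y) ^ 3) \<longlongrightarrow> 0) at_top"
proof -
  define L where "L u = (- ln (1 - u) - u - u\<^sup>2 / 2 - u ^ 3 / 3) / u ^ 3" for u :: real
  have "(L \<longlongrightarrow> 0) (at 0)"
    unfolding L_def by real_asymp
  hence "isCont L 0" by (simp add: isCont_def L_def)
  from isCont_tendsto_compose[OF this tail_tendsto_0]
  show ?thesis by (simp add: L_def)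
qed

lemma tail_dev_tendsto_0: "(tail_dev \<longlongrightarrow> 0) at_top"
proof -
  have v12: "2 \<le> r \<Longrightarrow> v 1 < v 2" and v13: "3 \<le> r \<Longrightarrow> v 1 < v 3"
    using v_less[of 1 2] v_less[of 1 3] by auto
  have "((\<lambda>y. y powr 0 * (tail_dev y - power_sum tail_dev_terms y)) \<longlongrightarrow> 0) at_top"
    using v12 v13 by (intro tail_dev_expansion) force+
  moreover have "((\<lambda>y. y powr 0 * power_sum tail_dev_terms y) \<longlongrightarrow> coeff_at tail_dev_terms 0) at_top"
    using v12 v13 by (intro power_sum_tendsto) (auto simp: tail_dev_terms_def)
  moreover have "coeff_at tail_dev_terms 0 = 0"
    using v12 v13 by (auto simp: tail_dev_terms_def)
  ultimately have "((\<lambda>y. y powr 0 * (tail_dev y - power_sum tail_dev_terms y) + y powr 0 * power_sum tail_dev_terms y) \<longlongrightarrow> 0 + 0) at_top"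
    by (metis tendsto_add)
  hence "((\<lambda>y. y powr 0 * tail_dev y) \<longlongrightarrow> 0) at_top"
    by (simp add: algebra_simps)
  thus ?thesis
    by (rule Lim_transform_eventually)
       (use eventually_gt_at_top[of "0::real"] in \<open>eventually_elim, simp\<close>)
qed

text \<open>
  With $u = w (1 + \varepsilon)$ and $L$ the quotient of \<open>log_remainder_tendsto_0\<close>, the
  difference equals
  $(\varepsilon - E) + w (\varepsilon - E_0) + w \varepsilon^2 / 2
    + w^2 ((1 + \varepsilon)^3 - 1) / 3 + w^2 (1 + \varepsilon)^3 L$,
  where $E$ is the sum of \<open>tail_dev_terms\<close> and $E_0$ its part with exponents $2$ and
  $v_2 - v_1$. Each summand is $o(y^{-m})$: the factor $w^2$ is of order $y^{-2 v_1}$ with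
  $2 v_1 \ge m$, and $w \varepsilon$ is of order $y^{-m}$ at most because $v_1 + 2 \ge m$ and
  $v_2 \ge m$.
\<close>

lemma log_dev_expansion:
  assumes m4: "m \<le> 4" and m1: "m \<le> 2 * v 1" "m \<le> v 1 + 2"
    and m2: "2 \<le> r \<Longrightarrow> m \<le> v 2 - v 1 + 2" "2 \<le> r \<Longrightarrow> m \<le> v 2"
    and m3: "3 \<le> r \<Longrightarrow> m \<le> v 3 - v 1"
  shows "((\<lambda>y. y powr m * (log_dev y - power_sum log_dev_terms y)) \<longlongrightarrow> 0) at_top"
proof -
  define lead where "lead = (A1 v \<beta>, 2::real) # (if 2 \<le> r then [(A3 v \<beta> p, v 2 - v 1)] else [])"
  define rest where "rest = (A2 v \<beta>, 4::real) # (if 2 \<le> r then [(A4 v \<beta> p, v 2 - v 1 + 2)] else [])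
    @ (if 3 \<le> r then [(A5 v \<beta> p, v 3 - v 1)] else [])"
  have split: "power_sum tail_dev_terms y = power_sum lead y + power_sum rest y" for y
    by (simp add: tail_dev_terms_def lead_def rest_def)
  have T1: "((\<lambda>y. y powr m * (tail_dev y - power_sum tail_dev_terms y)) \<longlongrightarrow> 0) at_top"
    by (intro tail_dev_expansion m4 m2 m3)
  \<comment> \<open>A factor $w$ supplies $y^{-v_1}$, so its cofactor is needed to order $m - v_1$ only.\<close>
  let ?n = "m - v 1"
  have T2: "((\<lambda>y. y powr ?n * (tail_dev y - power_sum lead y)) \<longlongrightarrow> 0) at_top"
  proof -
    have "((\<lambda>y. y powr ?n * (tail_dev y - power_sum tail_dev_terms y)) \<longlongrightarrow> 0) at_top"
      using m4 m2 m3 v1_pos by (intro tail_dev_expansion) force+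
    moreover have "((\<lambda>y. y powr ?n * power_sum rest y) \<longlongrightarrow> coeff_at rest ?n) at_top"
      using m4 m2 m3 v1_pos by (intro power_sum_tendsto) (auto simp: rest_def)
    moreover have "coeff_at rest ?n = 0"
      using m4 m2 m3 v1_pos by (auto simp: rest_def)
    ultimately have "((\<lambda>y. y powr ?n * (tail_dev y - power_sum tail_dev_terms y) + y powr ?n * power_sum rest y) \<longlongrightarrow> 0 + 0) at_top"
      by (metis tendsto_add)
    thus ?thesis by (simp add: split algebra_simps)
  qed
  \<comment> \<open>One factor \<open>tail_dev\<close> compensates $y^{m - v_1}$, the other one tends to $0$.\<close>
  have T3: "((\<lambda>y. y powr ?n * tail_dev y * tail_dev y) \<longlongrightarrow> 0) at_top"
  proof -
    have "((\<lambda>y. y powr ?n * power_sum lead y) \<longlongrightarrow> coeff_at lead ?n) at_top"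
      using m1 m2 by (intro power_sum_tendsto) (auto simp: lead_def)
    hence "((\<lambda>y. (y powr ?n * (tail_dev y - power_sum lead y) + y powr ?n * power_sum lead y) * tail_dev y)
       \<longlongrightarrow> (0 + coeff_at lead ?n) * 0) at_top"
      by (intro tendsto_intros T2 tail_dev_tendsto_0)
    thus ?thesis by (simp add: algebra_simps)
  qed
  let ?P = "\<lambda>y. y powr m * y powr (- (2 * v 1))"
  have P: "(?P \<longlongrightarrow> of_bool (2 * v 1 = m)) at_top"
    by (intro powr_tendsto_of_bool m1)
  have T4: "((\<lambda>y. ?P y * ((1 + tail_dev y) ^ 3 - 1)) \<longlongrightarrow> of_bool (2 * v 1 = m) * ((1 + 0) ^ 3 - 1)) at_top"
    by (intro tendsto_intros P tail_dev_tendsto_0)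
  let ?L = "\<lambda>y. (- ln (F y) - (1 - F y) - (1 - F y)\<^sup>2 / 2 - (1 - F y) ^ 3 / 3) / (1 - F y) ^ 3"
  have T5: "((\<lambda>y. ?P y * (1 + tail_dev y) ^ 3 * ?L y) \<longlongrightarrow> of_bool (2 * v 1 = m) * (1 + 0) ^ 3 * 0) at_top"
    by (intro tendsto_intros P tail_dev_tendsto_0 log_remainder_tendsto_0)
  have "((\<lambda>y. y powr m * (tail_dev y - power_sum tail_dev_terms y)
       + 2 * \<kappa> * (y powr ?n * (tail_dev y - power_sum lead y))
       + \<kappa> * (y powr ?n * tail_dev y * tail_dev y)
       + 4 / 3 * \<kappa>\<^sup>2 * (?P y * ((1 + tail_dev y) ^ 3 - 1))
       + 4 * \<kappa>\<^sup>2 * (?P y * (1 + tail_dev y) ^ 3 * ?L y))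
     \<longlongrightarrow> 0 + 2 * \<kappa> * 0 + \<kappa> * 0 + 4 / 3 * \<kappa>\<^sup>2 * (of_bool (2 * v 1 = m) * ((1 + 0) ^ 3 - 1))
       + 4 * \<kappa>\<^sup>2 * (of_bool (2 * v 1 = m) * (1 + 0) ^ 3 * 0)) at_top"
    by (intro tendsto_add tendsto_mult tendsto_const T1 T2 T3 T4 T5)
  hence lim: "((\<lambda>y. y powr m * (tail_dev y - power_sum tail_dev_terms y)
       + 2 * \<kappa> * (y powr ?n * (tail_dev y - power_sum lead y))
       + \<kappa> * (y powr ?n * tail_dev y * tail_dev y)
       + 4 / 3 * \<kappa>\<^sup>2 * (?P y * ((1 + tail_dev y) ^ 3 - 1))
       + 4 * \<kappa>\<^sup>2 * (?P y * (1 + tail_dev y) ^ 3 * ?L y)) \<longlongrightarrow> 0) at_top"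
    by simp
  have "\<forall>\<^sub>F y in at_top. tail_dev y > - 1"
    using order_tendstoD(1)[OF tail_dev_tendsto_0, of "- 1"] by simp
  hence "\<forall>\<^sub>F y in at_top. y powr m * (tail_dev y - power_sum tail_dev_terms y)
       + 2 * \<kappa> * (y powr ?n * (tail_dev y - power_sum lead y))
       + \<kappa> * (y powr ?n * tail_dev y * tail_dev y)
       + 4 / 3 * \<kappa>\<^sup>2 * (?P y * ((1 + tail_dev y) ^ 3 - 1))
       + 4 * \<kappa>\<^sup>2 * (?P y * (1 + tail_dev y) ^ 3 * ?L y) = y powr m * (log_dev y - power_sum log_dev_terms y)"
    using eventually_gt_at_top[of 0]
  proof eventually_elim
    case (elim y)
    define q w where "q = y powr (- v 1)" and "w = 2 * \<kappa> * q"
    have q: "q > 0" using elim by (simp add: q_def)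
    have w: "w > 0" using q kappa_pos by (simp add: w_def)
    have qv: "y powr (v 1) = 1 / q"
      using elim by (simp add: q_def powr_minus_divide)
    have u: "1 - F y = w * (1 + tail_dev y)"
      unfolding tail_dev_def qv w_def using q kappa_pos by simp
    have n: "y powr ?n = y powr m * q"
      unfolding q_def by (simp flip: powr_add)
    have P': "?P y = y powr m * q\<^sup>2"
      unfolding q_def power2_eq_square by (simp flip: powr_add)
    have terms: "power_sum log_dev_terms y = power_sum tail_dev_terms y + w / 2 + w * power_sum lead y + w\<^sup>2 / 3"
    proof -
      have "y powr (- (v 1 + 2)) = q * y powr (- 2)" "y powr (- (2 * v 1)) = q * q"
        "y powr (- v 2) = q * y powr (- (v 2 - v 1))"
        unfolding q_def by (simp_all flip: powr_add)
      thus ?thesis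
        by (simp add: log_dev_terms_def lead_def w_def q_def[symmetric] power2_eq_square algebra_simps del: One_nat_def)
    qed
    define l where "l = ?L y"
    have log_eq: "- ln (F y) = (1 - F y) + (1 - F y)\<^sup>2 / 2 + (1 - F y) ^ 3 / 3 + (1 - F y) ^ 3 * l"
      unfolding l_def using u w elim by simp
    have "- ln (F y) = w * ((1 + tail_dev y) + w * (1 + tail_dev y)\<^sup>2 / 2
        + w\<^sup>2 * (1 + tail_dev y) ^ 3 / 3 + w\<^sup>2 * (1 + tail_dev y) ^ 3 * l)"
    proof -
      have "w * e + (w * e)\<^sup>2 / 2 + (w * e) ^ 3 / 3 + (w * e) ^ 3 * l
          = w * (e + w * e\<^sup>2 / 2 + w\<^sup>2 * e ^ 3 / 3 + w\<^sup>2 * e ^ 3 * l)" for e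
        by (simp add: field_simps power2_eq_square power3_eq_cube)
      thus ?thesis using log_eq unfolding u by simp
    qed
    moreover have "log_dev y = - ln (F y) / w - 1"
      unfolding log_dev_def qv w_def by simp
    ultimately have "log_dev y = (1 + tail_dev y) + w * (1 + tail_dev y)\<^sup>2 / 2
        + w\<^sup>2 * (1 + tail_dev y) ^ 3 / 3 + w\<^sup>2 * (1 + tail_dev y) ^ 3 * l - 1"
      using w by simp
    hence diff: "log_dev y - power_sum log_dev_terms y = (tail_dev y - power_sum tail_dev_terms y) + w * (tail_dev y - power_sum lead y)
        + w / 2 * (tail_dev y)\<^sup>2 + w\<^sup>2 / 3 * ((1 + tail_dev y) ^ 3 - 1) + w\<^sup>2 * (1 + tail_dev y) ^ 3 * l"
      unfolding terms by (simp add: field_simps power2_eq_square)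
    thus ?case
      unfolding n P' l_def[symmetric] diff w_def by (simp add: field_simps power2_eq_square)
  qed
  thus ?thesis by (rule Lim_transform_eventually[OF lim])
qed

end

section \<open>From the tail to powers of the distribution function\<close>

lemma exp_remainder_tendsto_0:
  assumes "(S \<longlongrightarrow> 0) A"
  shows "((\<lambda>n. (exp (- S n) - 1 + S n - (S n)\<^sup>2 / 2) / (S n)\<^sup>2) \<longlongrightarrow> (0::real)) A"
proof -
  \<comment> \<open>Division by zero gives the continuous extension at $0$.\<close>
  define g where "g s = (exp (- s) - 1 + s - s\<^sup>2 / 2) / s\<^sup>2" for s :: real
  have "(g \<longlongrightarrow> 0) (at 0)"
    unfolding g_def by real_asymp
  hence "isCont g 0" by (simp add: isCont_def g_def)
  from isCont_tendsto_compose[OF this assms] show ?thesis by (simp add: g_def)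
qed

text \<open>
  The expansion $e^{-S} - 1 = - S + S^2/2 + o(S^2)$ with $S \sim b a_n^{-\theta}$. The
  square has order $a_n^{-2 \theta}$, hence it is visible at order $a_n^{-(\theta + \gamma)}$
  precisely if $\gamma = \theta$.
\<close>

lemma exp_second_order:
  fixes a S :: "nat \<Rightarrow> real"
  assumes a: "filterlim a at_top sequentially" and \<theta>: "0 < \<theta>" and \<gamma>: "0 < \<gamma>" "\<gamma> \<le> \<theta>"
    and S: "(\<lambda>n. a n powr (\<theta> + \<gamma>) * (S n - b * a n powr (- \<theta>))) \<longlonglongrightarrow> c"
  shows "(\<lambda>n. a n powr \<gamma> * (a n powr \<theta> * (exp (- S n) - 1) + b)) \<longlonglongrightarrow> of_bool (\<gamma> = \<theta>) * b\<^sup>2 / 2 - c"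
proof -
  have apos: "\<forall>\<^sub>F n in sequentially. a n > 0"
    using a by (simp add: filterlim_at_top_dense)
  have neg: "(\<lambda>n. a n powr (- e)) \<longlonglongrightarrow> 0" if "e > 0" for e
    using that by (intro tendsto_neg_powr a) auto
  have "(\<lambda>n. a n powr (- \<gamma>) * (a n powr (\<theta> + \<gamma>) * (S n - b * a n powr (- \<theta>))) + b) \<longlonglongrightarrow> 0 * c + b"
    by (intro tendsto_intros neg S \<gamma>)
  hence "(\<lambda>n. a n powr (- \<gamma>) * (a n powr (\<theta> + \<gamma>) * (S n - b * a n powr (- \<theta>))) + b) \<longlonglongrightarrow> b"
    by simp
  hence lead: "(\<lambda>n. a n powr \<theta> * S n) \<longlonglongrightarrow> b"
  proof (rule Lim_transform_eventually)
    show "\<forall>\<^sub>F n in sequentially. a n powr (- \<gamma>) * (a n powr (\<theta> + \<gamma>) * (S n - b * a n powr (- \<theta>))) + b = a n powr \<theta> * S n"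
      using apos by eventually_elim (simp add: powr_add powr_minus field_simps)
  qed
  have "(\<lambda>n. a n powr (- \<theta>) * (a n powr \<theta> * S n)) \<longlonglongrightarrow> 0 * b"
    by (intro tendsto_intros neg lead \<theta>)
  hence "(\<lambda>n. a n powr (- \<theta>) * (a n powr \<theta> * S n)) \<longlonglongrightarrow> 0" by simp
  hence S0: "S \<longlonglongrightarrow> 0"
    by (rule Lim_transform_eventually) (use apos in \<open>eventually_elim, simp add: powr_minus\<close>)
  have P: "(\<lambda>n. a n powr \<gamma> * a n powr (- \<theta>)) \<longlonglongrightarrow> of_bool (\<gamma> = \<theta>)"
    using filterlim_compose[OF powr_tendsto_of_bool[OF \<gamma>(2)] a] by (simp add: eq_commute)
  let ?g = "\<lambda>n. (exp (- S n) - 1 + S n - (S n)\<^sup>2 / 2) / (S n)\<^sup>2"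
  have lim: "(\<lambda>n. - (a n powr (\<theta> + \<gamma>) * (S n - b * a n powr (- \<theta>)))
          + a n powr \<gamma> * a n powr (- \<theta>) * (a n powr \<theta> * S n)\<^sup>2 * (1 / 2 + ?g n))
        \<longlonglongrightarrow> - c + of_bool (\<gamma> = \<theta>) * b\<^sup>2 * (1 / 2 + 0)"
    by (intro tendsto_intros S P lead exp_remainder_tendsto_0 S0)
  have eq: "\<forall>\<^sub>F n in sequentially. - (a n powr (\<theta> + \<gamma>) * (S n - b * a n powr (- \<theta>)))
          + a n powr \<gamma> * a n powr (- \<theta>) * (a n powr \<theta> * S n)\<^sup>2 * (1 / 2 + ?g n)
       = a n powr \<gamma> * (a n powr \<theta> * (exp (- S n) - 1) + b)"
    using apos
  proof eventually_elim
    case (elim n)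
    have "exp (- S n) - 1 = - S n + (S n)\<^sup>2 * (1 / 2 + ?g n)"
      by (cases "S n = 0") (simp_all add: field_simps)
    moreover define g where "g = ?g n"
    ultimately have e: "exp (- S n) - 1 = - S n + (S n)\<^sup>2 * (1 / 2 + g)" by simp
    show ?case
      unfolding e g_def[symmetric] using elim
      by (simp add: powr_add powr_minus power_mult_distrib) (simp add: field_simps power2_eq_square)
  qed
  show ?thesis
    using Lim_transform_eventually[OF lim eq] by (simp add: algebra_simps)
qed

context skew_t_mixture
begin

abbreviation "a \<equiv> norming v \<beta> p"

lemma norming_eq: "a n = (2 * \<kappa> * real n) powr (1 / v 1)"
proof -
  have 0: "p 1 > 0" "student_const (v 1) > 0" "student_cdf (v 1 + 1) (\<beta> 1 * sqrt (v 1 + 1)) > 0"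
    using p_pos r v1_pos by (auto intro!: student_const_pos student_cdf_pos)
  have "v 1 powr ((v 1 - 1) / (2 * v 1)) = (v 1 powr ((v 1 - 1) / 2)) powr (1 / v 1)"
    by (simp add: powr_powr)
  moreover have eq: "2 * \<kappa> * real n = 2 * p 1 * student_const (v 1) * student_cdf (v 1 + 1) (\<beta> 1 * sqrt (v 1 + 1))
      * v 1 powr ((v 1 - 1) / 2) * real n"
    by (simp add: kappa_def mult_ac)
  ultimately show ?thesis
    unfolding norming_def eq using 0 by (simp add: powr_mult)
qed

lemma norming_powr: "a n powr (v 1) = 2 * \<kappa> * real n"
  unfolding norming_eq using v1_pos kappa_pos by (simp add: powr_powr)

lemma norming_at_top: "filterlim a at_top sequentially"
proof -
  have "filterlim (\<lambda>n. (c * real n) powr e) at_top sequentially" if "c > 0" "e > 0" for c e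
    using that by real_asymp
  thus ?thesis unfolding norming_eq using v1_pos kappa_pos by simp
qed

text \<open>
  The logarithm of the left-hand side is $n \ln F(y)$ with $y = a_n x$, and
  $n = a_n^{v_1} / (2 \kappa)$ cancels the leading factor of $- \ln F(y)$ up to $x^{-v_1}$.
\<close>

lemma power_eq_exp_log_dev:
  assumes x: "x > 0"
  shows "\<forall>\<^sub>F n in sequentially. F (a n * x) ^ n = Frechet (v 1) x * exp (- (x powr (- v 1) * log_dev (a n * x)))"
proof -
  have ax: "filterlim (\<lambda>n. a n * x) at_top sequentially"
    using filterlim_at_top_mult_tendsto_pos[OF tendsto_const x norming_at_top] by simp
  have "\<forall>\<^sub>F y in at_top. 1 - F y < 1"
    using order_tendstoD(2)[OF tail_tendsto_0, of 1] by simp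
  hence "\<forall>\<^sub>F y in at_top. F y > 0"
    by eventually_elim simp
  hence "\<forall>\<^sub>F n in sequentially. F (a n * x) > 0"
    using ax by (rule eventually_compose_filterlim)
  moreover have "\<forall>\<^sub>F n in sequentially. a n > 0"
    using norming_at_top by (simp add: filterlim_at_top_dense)
  ultimately show ?thesis
  proof eventually_elim
    case (elim n)
    define l where "l = ln (F (a n * x))"
    have "x powr (- v 1) * (1 + log_dev (a n * x)) = - l * (a n powr v 1 / (2 * \<kappa>)) * (x powr (- v 1) * x powr v 1)"
      unfolding log_dev_def l_def using elim x by (simp add: powr_mult field_simps)
    also have "\<dots> = - l * real n"
      unfolding norming_powr using x kappa_pos by (simp flip: powr_add)
    finally have "real n * l = - (x powr (- v 1)) + - (x powr (- v 1) * log_dev (a n * x))"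
      by (simp add: algebra_simps)
    hence "exp (real n * l) = Frechet (v 1) x * exp (- (x powr (- v 1) * log_dev (a n * x)))"
      unfolding Frechet_def exp_add[symmetric] by simp
    moreover have "F (a n * x) ^ n = exp (real n * l)"
      using elim by (simp add: l_def exp_of_nat_mult)
    ultimately show ?case by simp
  qed
qed

text \<open>
  All seven regimes are instances: a regime fixes $\theta$ and $\gamma$, and what remains is
  to compare exponents.
\<close>

lemma second_order_limit:
  assumes x: "x > 0" and \<theta>: "0 < \<theta>" and \<gamma>: "0 < \<gamma>" "\<gamma> \<le> \<theta>" and m: "m = \<theta> + \<gamma>"
    and m4: "m \<le> 4" and m1: "m \<le> 2 * v 1" "m \<le> v 1 + 2"
    and m2: "2 \<le> r \<Longrightarrow> m \<le> v 2 - v 1 + 2" "2 \<le> r \<Longrightarrow> m \<le> v 2"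
    and m3: "3 \<le> r \<Longrightarrow> m \<le> v 3 - v 1"
    and exponents: "\<forall>(c, e)\<in>set log_dev_terms. e = \<theta> \<or> e \<ge> m"
    and k: "k = - coeff_at log_dev_terms \<theta> * x powr (- v 1 - \<theta>)"
    and \<omega>: "\<omega> = of_bool (\<gamma> = \<theta>) * k\<^sup>2 / 2 - coeff_at log_dev_terms m * x powr (- v 1 - m)"
  shows "(\<lambda>n. a n powr \<gamma> * (a n powr \<theta> * (F (a n * x) ^ n - Frechet (v 1) x) - k * Frechet (v 1) x))
    \<longlonglongrightarrow> \<omega> * Frechet (v 1) x"
proof -
  let ?C = "coeff_at log_dev_terms"
  have ax: "filterlim (\<lambda>n. a n * x) at_top sequentially"
    using filterlim_at_top_mult_tendsto_pos[OF tendsto_const x norming_at_top] by simp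
  have "((\<lambda>y. y powr m * (log_dev y - power_sum log_dev_terms y)
      + y powr m * (power_sum log_dev_terms y - ?C \<theta> * y powr (- \<theta>))) \<longlongrightarrow> 0 + ?C m) at_top"
    using m \<gamma> by (intro tendsto_add log_dev_expansion power_sum_two_terms m4 m1 m2 m3 exponents) auto
  hence log_dev_lim: "((\<lambda>y. y powr m * (log_dev y - ?C \<theta> * y powr (- \<theta>))) \<longlongrightarrow> ?C m) at_top"
    by (simp add: algebra_simps)
  define S where "S n = x powr (- v 1) * log_dev (a n * x)" for n
  have "(\<lambda>n. x powr (- v 1 - m) * ((a n * x) powr m * (log_dev (a n * x) - ?C \<theta> * (a n * x) powr (- \<theta>))))
      \<longlonglongrightarrow> x powr (- v 1 - m) * ?C m"
    by (intro tendsto_intros filterlim_compose[OF log_dev_lim ax])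
  hence "(\<lambda>n. a n powr (\<theta> + \<gamma>) * (S n - (- k) * a n powr (- \<theta>))) \<longlonglongrightarrow> x powr (- v 1 - m) * ?C m"
  proof (rule Lim_transform_eventually)
    have "\<forall>\<^sub>F n in sequentially. a n > 0"
      using norming_at_top by (simp add: filterlim_at_top_dense)
    thus "\<forall>\<^sub>F n in sequentially. x powr (- v 1 - m) * ((a n * x) powr m * (log_dev (a n * x) - ?C \<theta> * (a n * x) powr (- \<theta>)))
       = a n powr (\<theta> + \<gamma>) * (S n - (- k) * a n powr (- \<theta>))"
    proof eventually_elim
      case (elim n)
      have s: "x powr (- v 1 - m) * x powr m = x powr (- v 1)"
        "x powr (- v 1 - \<theta>) = x powr (- v 1) * x powr (- \<theta>)"
        by (simp_all flip: powr_add)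
      have "x powr (- v 1 - m) * ((a n * x) powr m * (log_dev (a n * x) - ?C \<theta> * (a n * x) powr (- \<theta>)))
         = (x powr (- v 1 - m) * x powr m) * a n powr m * (log_dev (a n * x) - ?C \<theta> * (a n powr (- \<theta>) * x powr (- \<theta>)))"
        using elim x by (simp add: powr_mult)
      also have "\<dots> = a n powr (\<theta> + \<gamma>) * (S n - (- k) * a n powr (- \<theta>))"
        unfolding s(1) unfolding k S_def s(2) unfolding m by (simp add: algebra_simps)
      finally show ?case .
    qed
  qed
  from exp_second_order[where a = a and S = S and b = "- k", OF norming_at_top \<theta> \<gamma> this]
  have "(\<lambda>n. a n powr \<gamma> * (a n powr \<theta> * (exp (- S n) - 1) + - k))
      \<longlonglongrightarrow> of_bool (\<gamma> = \<theta>) * (- k)\<^sup>2 / 2 - x powr (- v 1 - m) * ?C m" .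
  moreover have "of_bool (\<gamma> = \<theta>) * (- k)\<^sup>2 / 2 - x powr (- v 1 - m) * ?C m = \<omega>"
    unfolding \<omega> by simp
  ultimately have "(\<lambda>n. a n powr \<gamma> * (a n powr \<theta> * (exp (- S n) - 1) + - k)) \<longlonglongrightarrow> \<omega>" by simp
  from tendsto_mult[OF this tendsto_const[of "Frechet (v 1) x"]]
  show ?thesis
  proof (rule Lim_transform_eventually)
    show "\<forall>\<^sub>F n in sequentially. a n powr \<gamma> * (a n powr \<theta> * (exp (- S n) - 1) + - k) * Frechet (v 1) x
      = a n powr \<gamma> * (a n powr \<theta> * (F (a n * x) ^ n - Frechet (v 1) x) - k * Frechet (v 1) x)"
      using power_eq_exp_log_dev[OF x]
    proof eventually_elim
      case (elim n)
      show ?case unfolding elim S_def[symmetric] by (simp add: algebra_simps)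
    qed
  qed
qed

end

section \<open>The seven regimes\<close>

text \<open>
  A missing component contributes $\infty$ to the minimum; in real terms it may as well contribute
  a number that occurs in the minimum anyway.
\<close>

lemma gamma1_eq: "gamma1 r v = min (min 2 (2 * v 1)) (if 2 \<le> r then v 2 - v 1 else 2) - v 1"
  by (auto simp: gamma1_def dof_def min_def)

lemma gamma2_eq: "gamma2 r v = min (min 4 (v 1)) (if 2 \<le> r then v 2 - v 1 else 4) - 2"
  by (auto simp: gamma2_def dof_def min_def)

lemma gamma3_eq: "2 \<le> r \<Longrightarrow> gamma3 r v = min (min 2 (min (v 1) (2 * (v 2 - v 1)))) (if 3 \<le> r then v 3 - v 1 else 2) - v 2 + v 1"
  by (auto simp: gamma3_def dof_def min_def)

lemma gamma4_eq: "gamma4 r v = min 4 (if 2 \<le> r then v 2 - 2 else 4) - 2"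
  by (auto simp: gamma4_def dof_def min_def)

lemma gamma5_eq: "gamma5 r v = min (min 4 (v 1)) (if 3 \<le> r then v 3 - v 1 else 4) - 2"
  by (auto simp: gamma5_def dof_def min_def)

lemma gamma6_eq: "gamma6 r v = min (min 2 (2 * v 1)) (if 3 \<le> r then v 3 - v 1 else 2) - v 1"
  by (auto simp: gamma6_def dof_def min_def)

lemma gamma7_eq: "gamma7 r v = min 4 (if 3 \<le> r then v 3 - 2 else 4) - 2"
  by (auto simp: gamma7_def dof_def min_def)

lemma ereal_arith:
  "(1::ereal) = ereal 1" "(numeral w :: ereal) = ereal (numeral w)"
  "ereal a + ereal b = ereal (a + b)" "ereal a * ereal b = ereal (a * b)"
  "ereal 3 / ereal 2 = ereal (3 / 2)" "ereal a / ereal 2 = ereal (a / 2)"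
  by (simp_all add: one_ereal_def)

lemma dof_iff:
  "dof r v i \<le> ereal c \<longleftrightarrow> i \<le> r \<and> v i \<le> c" "ereal c \<le> dof r v i \<longleftrightarrow> (i \<le> r \<longrightarrow> c \<le> v i)"
  "dof r v i < ereal c \<longleftrightarrow> i \<le> r \<and> v i < c" "ereal c < dof r v i \<longleftrightarrow> (i \<le> r \<longrightarrow> c < v i)"
  "dof r v i = ereal c \<longleftrightarrow> i \<le> r \<and> v i = c"
  "dof r v i < dof r v j \<longleftrightarrow> i \<le> r \<and> (j \<le> r \<longrightarrow> v i < v j)"
  "(ereal a + dof r v j) / ereal 2 \<le> dof r v i \<longleftrightarrow> (i \<le> r \<longrightarrow> j \<le> r \<and> (a + v j) / 2 \<le> v i)"
  "dof r v i \<le> (ereal a + dof r v j) / ereal 2 \<longleftrightarrow> (j \<le> r \<longrightarrow> i \<le> r \<and> v i \<le> (a + v j) / 2)"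
  by (auto simp: dof_def)

lemma of_bool_add_disjoint:
  "\<not> (P \<and> Q) \<Longrightarrow> of_bool P + of_bool Q = (of_bool (P \<or> Q) :: real)"
  by auto

lemmas omega_real_conditions = ereal_arith dof_iff

context skew_t_mixture
begin

text \<open>
  Entries of the list with exponent $t$ carry the power $x^{-v_1 - t}$. Writing each of them with
  its own exponent produces the powers of $x$ that occur in the limits.
\<close>

lemma coeff_at_powr:
  "coeff_at log_dev_terms t * x powr (- v 1 - t) =
     of_bool (t = 2) * A1 v \<beta> * x powr (- v 1 - 2)
   + of_bool (t = 4) * A2 v \<beta> * x powr (- v 1 - 4)
   + of_bool (2 \<le> r \<and> t = v 2 - v 1) * A3 v \<beta> p * x powr (- v 2)
   + of_bool (2 \<le> r \<and> t = v 2 - v 1 + 2) * A4 v \<beta> p * x powr (- v 2 - 2)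
   + of_bool (3 \<le> r \<and> t = v 3 - v 1) * A5 v \<beta> p * x powr (- v 3)
   + of_bool (t = v 1) * \<kappa> * x powr (- 2 * v 1)
   + of_bool (t = v 1 + 2) * 2 * \<kappa> * A1 v \<beta> * x powr (- 2 * v 1 - 2)
   + of_bool (t = 2 * v 1) * (4 / 3 * \<kappa>\<^sup>2 * x powr (- 3 * v 1))
   + of_bool (2 \<le> r \<and> t = v 2) * 2 * A3 v \<beta> p * \<kappa> * x powr (- v 2 - v 1)"
proof -
  have move: "of_bool (e = t) * c * x powr (- v 1 - t) = of_bool (t = e) * c * x powr (- v 1 - e)" for c e
    by auto
  have e: "- v 1 - (v i - v 1) = - v i" "- v 1 - (v i - v 1 + 2) = - v i - 2" "- v 1 - v 1 = - 2 * v 1"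
    "- v 1 - (v 1 + 2) = - 2 * v 1 - 2" "- v 1 - 2 * v 1 = - 3 * v 1" "- v 1 - v 2 = - v 2 - v 1" for i
    by simp_all
  have split: "coeff_at (if b then [(c, d)] else []) t = of_bool (d = t) * (of_bool b * c)"
    "coeff_at (if b then [(c, d), (c', d')] else []) t = of_bool (d = t) * (of_bool b * c) + of_bool (d' = t) * (of_bool b * c')"
    for b c d c' d' by auto
  show ?thesis
    unfolding log_dev_terms_def tail_dev_terms_def coeff_at_append coeff_at_simps split distrib_right move e
    by (simp add: of_bool_conj mult_ac del: One_nat_def)
qed


text \<open>
  For $v_1 = 2$ the factors $C_2 = 1 / (2 \sqrt 2)$ and $v_1^{(v_1 - 1)/2} = \sqrt 2$ have the product $1/2$.
\<close>

lemma kappa_2: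
  assumes "v 1 = 2"
  shows "\<kappa> = p 1 * student_cdf 3 (sqrt 3 * \<beta> 1) / 2"
proof -
  have gamma: "Gamma (3 / 2 :: real) = sqrt pi / 2"
  proof -
    have "(1 / 2 :: real) \<notin> \<int>\<^sub>\<le>\<^sub>0"
      using nonpos_Ints_nonpos[of "1 / 2 :: real"] by auto
    thus ?thesis
      using Gamma_plus1[of "1 / 2 :: real"] by (simp add: Gamma_one_half_real)
  qed
  have "student_const 2 = 1 / (2 * sqrt 2)"
    by (simp add: student_const_def real_sqrt_mult gamma)
  moreover have "2 powr (1 / 2) = sqrt (2::real)"
    by (simp add: powr_half_sqrt)
  ultimately show ?thesis
    unfolding kappa_def assms by (simp add: mult.commute)
qed


text \<open>
  In each of the following proofs $m$ is the second order, that is the minimum defining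
  $\gamma$. The facts called \<open>conds\<close> say that the indicators in $\omega$ single out
  the terms whose exponent attains this minimum, and the facts called \<open>z\<close> list the terms of
  \<open>log_dev_terms\<close> without influence at the order considered.
  
  Here $v_1$ is the smallest exponent: the first deviation comes from the logarithm alone, and the
  third-order term $\frac43 \kappa^2$ competes with the tail correction and the second
  component.
\<close>

lemma limit_logarithm:
  assumes x: "x > 0" and v1: "v 1 < 2" and v2: "2 \<le> r \<Longrightarrow> 2 * v 1 < v 2"
  shows "(\<lambda>n. a n powr gamma1 r v * (a n powr (v 1) * (F (a n * x) ^ n - Frechet (v 1) x)
      - k1 v \<beta> p x * Frechet (v 1) x)) \<longlonglongrightarrow> omega1 r v \<beta> p x * Frechet (v 1) x"
proof -
  define m where "m = v 1 + gamma1 r v"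
  have m_le: "m \<le> 2" "m \<le> 2 * v 1" "2 \<le> r \<Longrightarrow> m \<le> v 2 - v 1"
    and m_cases: "m = 2 \<or> m = 2 * v 1 \<or> 2 \<le> r \<and> m = v 2 - v 1"
    by (auto simp: m_def gamma1_eq)
  have v23: "3 \<le> r \<Longrightarrow> v 2 < v 3" using v_less[of 2 3] by auto
  have m_gt: "m > v 1" using m_cases v1 v1_pos v2 v23 by auto
  show ?thesis
  proof (rule second_order_limit[where m = m])
    show "\<forall>(c, e)\<in>set log_dev_terms. e = v 1 \<or> e \<ge> m"
      using m_le v1 v1_pos v2 v23 by (auto simp: log_dev_terms_def tail_dev_terms_def)
    show "k1 v \<beta> p x = - coeff_at log_dev_terms (v 1) * x powr (- v 1 - v 1)"
    proof -
      have z: "v 1 \<noteq> 2" "v 1 \<noteq> 4" "\<not> (2 \<le> r \<and> v 1 = v 2 - v 1)"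
        "\<not> (2 \<le> r \<and> v 1 = v 2 - v 1 + 2)"
        "\<not> (3 \<le> r \<and> v 1 = v 3 - v 1)" "v 1 \<noteq> v 1 + 2"
        "v 1 \<noteq> 2 * v 1" "\<not> (2 \<le> r \<and> v 1 = v 2)"
        using v1 v1_pos v2 v23 by auto
      show ?thesis unfolding mult_minus_left coeff_at_powr k1_def by (simp only: z) simp
    qed
    have conds: "2 \<le> r \<and> m = v 2 - v 1 \<longleftrightarrow> (0 < v 1 \<and> v 1 < 1 \<and> (2 \<le> r \<longrightarrow> 2 * v 1 < v 2) \<and> 2 \<le> r \<and> v 2 \<le> 3 * v 1)
        \<or> (1 \<le> v 1 \<and> v 1 < 2 \<and> (2 \<le> r \<longrightarrow> 2 * v 1 < v 2) \<and> 2 \<le> r \<and> v 2 \<le> v 1 + 2)"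
        "m = 2 * v 1 \<longleftrightarrow> 0 < v 1 \<and> v 1 \<le> 1 \<and> (2 \<le> r \<longrightarrow> 3 * v 1 \<le> v 2)"
        "m = 2 \<longleftrightarrow> 1 \<le> v 1 \<and> v 1 < 2 \<and> (2 \<le> r \<longrightarrow> v 1 + 2 \<le> v 2)"
        "gamma1 r v = v 1 \<longleftrightarrow> 0 < v 1 \<and> v 1 \<le> 1 \<and> (2 \<le> r \<longrightarrow> 3 * v 1 \<le> v 2)"
      using m_le m_cases m_gt v1 v1_pos v2 v23 m_def by (smt (verit))+
    have z: "m \<noteq> 4" "\<not> (2 \<le> r \<and> m = v 2 - v 1 + 2)"
        "\<not> (3 \<le> r \<and> m = v 3 - v 1)" "m \<noteq> v 1" "m \<noteq> v 1 + 2"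
        "\<not> (2 \<le> r \<and> m = v 2)"
      using m_le m_gt v1 v1_pos v2 v23 by auto
    show "omega1 r v \<beta> p x = of_bool (gamma1 r v = v 1) * (k1 v \<beta> p x)\<^sup>2 / 2
      - coeff_at log_dev_terms m * x powr (- v 1 - m)"
      unfolding coeff_at_powr omega1_def omega_real_conditions conds
      by (subst of_bool_add_disjoint, (auto)[1], simp only: conds z, simp add: algebra_simps)
  qed (use x m_gt m_le m_cases v1_pos v2 v23 v1 m_def in auto)
qed

text \<open>
  The smallest exponent is $2$, so the first deviation comes from the tail of the first component.
\<close>

lemma limit_tail_correction:
  assumes x: "x > 0" and v1: "v 1 > 2" and v2: "2 \<le> r \<Longrightarrow> v 1 + 2 < v 2"
  shows "(\<lambda>n. a n powr gamma2 r v * (a n powr 2 * (F (a n * x) ^ n - Frechet (v 1) x)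
      - k2 v \<beta> p x * Frechet (v 1) x)) \<longlonglongrightarrow> omega2 r v \<beta> p x * Frechet (v 1) x"
proof -
  define m where "m = 2 + gamma2 r v"
  have m_le: "m \<le> 4" "m \<le> v 1" "2 \<le> r \<Longrightarrow> m \<le> v 2 - v 1"
    and m_cases: "m = 4 \<or> m = v 1 \<or> 2 \<le> r \<and> m = v 2 - v 1"
    by (auto simp: m_def gamma2_eq)
  have v23: "3 \<le> r \<Longrightarrow> v 2 < v 3" using v_less[of 2 3] by auto
  have m_gt: "m > 2" using m_cases v1 v1_pos v2 v23 by auto
  show ?thesis
  proof (rule second_order_limit[where m = m])
    show "\<forall>(c, e)\<in>set log_dev_terms. e = 2 \<or> e \<ge> m"
      using m_le v1 v1_pos v2 v23 by (auto simp: log_dev_terms_def tail_dev_terms_def)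
    show "k2 v \<beta> p x = - coeff_at log_dev_terms 2 * x powr (- v 1 - 2)"
    proof -
      have z: "(2::real) \<noteq> 4" "\<not> (2 \<le> r \<and> 2 = v 2 - v 1)"
        "\<not> (2 \<le> r \<and> 2 = v 2 - v 1 + 2)"
        "\<not> (3 \<le> r \<and> 2 = v 3 - v 1)" "2 \<noteq> v 1" "2 \<noteq> v 1 + 2"
        "2 \<noteq> 2 * v 1" "\<not> (2 \<le> r \<and> 2 = v 2)"
        using v1 v1_pos v2 v23 by auto
      show ?thesis unfolding mult_minus_left coeff_at_powr k2_def by (simp only: z) simp
    qed
    have conds: "m = 4 \<longleftrightarrow> 4 \<le> v 1 \<and> (2 \<le> r \<longrightarrow> v 1 + 4 \<le> v 2)"
        "2 \<le> r \<and> m = v 2 - v 1 \<longleftrightarrow> (2 < v 1 \<and> v 1 < 4 \<and> (2 \<le> r \<longrightarrow> v 1 + 2 < v 2) \<and> 2 \<le> r \<and> v 2 \<le> 2 * v 1)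
        \<or> (4 \<le> v 1 \<and> (2 \<le> r \<longrightarrow> v 1 + 2 < v 2) \<and> 2 \<le> r \<and> v 2 \<le> v 1 + 4)"
        "m = v 1 \<longleftrightarrow> 2 < v 1 \<and> v 1 \<le> 4 \<and> (2 \<le> r \<longrightarrow> 2 * v 1 \<le> v 2)"
        "gamma2 r v = 2 \<longleftrightarrow> 4 \<le> v 1 \<and> (2 \<le> r \<longrightarrow> v 1 + 4 \<le> v 2)"
      using m_le m_cases m_gt v1 v1_pos v2 v23 m_def by (smt (verit))+
    have z: "m \<noteq> 2" "\<not> (2 \<le> r \<and> m = v 2 - v 1 + 2)"
        "\<not> (3 \<le> r \<and> m = v 3 - v 1)" "m \<noteq> v 1 + 2" "m \<noteq> 2 * v 1"
        "\<not> (2 \<le> r \<and> m = v 2)"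
      using m_le m_gt v1 v1_pos v2 v23 by auto
    show "omega2 r v \<beta> p x = of_bool (gamma2 r v = 2) * (k2 v \<beta> p x)\<^sup>2 / 2
      - coeff_at log_dev_terms m * x powr (- v 1 - m)"
      unfolding coeff_at_powr omega2_def omega_real_conditions conds
      by (subst of_bool_add_disjoint, (auto)[1], simp only: conds z, simp add: algebra_simps)
  qed (use x m_gt m_le m_cases v1_pos v2 v23 v1 m_def in auto)
qed

text \<open>
  The smallest exponent is $v_2 - v_1$. The two indicators at $A_5$, and likewise the four at
  $A_3^2$, exclude each other, and together they express one condition: that $v_3 - v_1$,
  respectively $2 (v_2 - v_1)$, attains the minimum.
\<close>

lemma limit_second_component:
  assumes x: "x > 0" and v1: "v 1 < v 2" and v2: "2 \<le> r" and v3: "v 2 < 2 * v 1" "v 2 < v 1 + 2"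
  shows "(\<lambda>n. a n powr gamma3 r v * (a n powr (v 2 - v 1) * (F (a n * x) ^ n - Frechet (v 1) x)
      - k3 v \<beta> p x * Frechet (v 1) x)) \<longlonglongrightarrow> omega3 r v \<beta> p x * Frechet (v 1) x"
proof -
  define m where "m = v 2 - v 1 + gamma3 r v"
  have m_le: "m \<le> 2" "m \<le> v 1" "m \<le> 2 * (v 2 - v 1)"
        "3 \<le> r \<Longrightarrow> m \<le> v 3 - v 1"
    and m_cases: "m = 2 \<or> m = v 1 \<or> m = 2 * (v 2 - v 1) \<or> 3 \<le> r \<and> m = v 3 - v 1"
    by (auto simp: m_def gamma3_eq[OF v2])
  have v23: "3 \<le> r \<Longrightarrow> v 2 < v 3" using v_less[of 2 3] by auto
  have m_gt: "m > v 2 - v 1" using m_cases v1 v1_pos v2 v23 v3 by auto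
  show ?thesis
  proof (rule second_order_limit[where m = m])
    show "\<forall>(c, e)\<in>set log_dev_terms. e = v 2 - v 1 \<or> e \<ge> m"
      using m_le v1 v1_pos v2 v3 v23 by (auto simp: log_dev_terms_def tail_dev_terms_def)
    show "k3 v \<beta> p x = - coeff_at log_dev_terms (v 2 - v 1) * x powr (- v 1 - (v 2 - v 1))"
    proof -
      have z: "v 2 - v 1 \<noteq> 2" "v 2 - v 1 \<noteq> 4"
        "(2 \<le> r \<and> v 2 - v 1 = v 2 - v 1) = True"
        "\<not> (2 \<le> r \<and> v 2 - v 1 = v 2 - v 1 + 2)"
        "\<not> (3 \<le> r \<and> v 2 - v 1 = v 3 - v 1)" "v 2 - v 1 \<noteq> v 1"
        "v 2 - v 1 \<noteq> v 1 + 2" "v 2 - v 1 \<noteq> 2 * v 1"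
        "\<not> (2 \<le> r \<and> v 2 - v 1 = v 2)"
        using v1 v1_pos v2 v3 v23 by auto
      show ?thesis unfolding mult_minus_left coeff_at_powr k3_def by (simp only: z) simp
    qed
    have halves: "3 / 2 * v 1 \<le> v 2 \<longleftrightarrow> v 1 \<le> 2 * (v 2 - v 1)" "v 2 \<le> 3 * v 1 / 2 \<longleftrightarrow> 2 * (v 2 - v 1) \<le> v 1"
      "(v 1 + v 3) / 2 \<le> v 2 \<longleftrightarrow> v 3 - v 1 \<le> 2 * (v 2 - v 1)" "v 2 \<le> (v 1 + v 3) / 2 \<longleftrightarrow> 2 * (v 2 - v 1) \<le> v 3 - v 1"
      by auto
    have conds: "m = 2 \<longleftrightarrow> 2 \<le> v 1 \<and> (2 \<le> r \<longrightarrow> v 1 + 1 \<le> v 2) \<and> (2 \<le> r \<and> v 2 < v 1 + 2) \<and> (3 \<le> r \<longrightarrow> v 1 + 2 \<le> v 3)"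
        "m = v 1 \<longleftrightarrow> 0 < v 1 \<and> v 1 \<le> 2 \<and> (2 \<le> r \<longrightarrow> 3 / 2 * v 1 \<le> v 2) \<and> (2 \<le> r \<and> v 2 < 2 * v 1) \<and> (3 \<le> r \<longrightarrow> 2 * v 1 \<le> v 3)"
      unfolding halves using m_le m_cases m_gt v1 v1_pos v2 v3 v23 m_def by (smt (verit))+
    have z: "m \<noteq> 4" "\<not> (2 \<le> r \<and> m = v 2 - v 1)"
        "\<not> (2 \<le> r \<and> m = v 2 - v 1 + 2)" "m \<noteq> v 1 + 2"
        "m \<noteq> 2 * v 1" "\<not> (2 \<le> r \<and> m = v 2)"
      using m_le m_gt v1 v1_pos v2 v3 v23 by auto
    show "omega3 r v \<beta> p x = of_bool (gamma3 r v = v 2 - v 1) * (k3 v \<beta> p x)\<^sup>2 / 2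
      - coeff_at log_dev_terms m * x powr (- v 1 - m)"
    proof -
      let ?Q1 = "(0 < v 1 \<and> v 1 < 2 \<and> (2 \<le> r \<longrightarrow> 3 \<le> r \<and> (v 1 + v 3) / 2 \<le> v 2) \<and> (2 \<le> r \<and> v 2 < 2 * v 1)
          \<and> (2 \<le> r \<and> (3 \<le> r \<longrightarrow> v 2 < v 3)) \<and> 3 \<le> r \<and> v 3 \<le> 2 * v 1)"
      let ?Q2 = "(2 \<le> v 1 \<and> (2 \<le> r \<longrightarrow> 3 \<le> r \<and> (v 1 + v 3) / 2 \<le> v 2) \<and> (2 \<le> r \<and> v 2 < v 1 + 2)
          \<and> (2 \<le> r \<and> (3 \<le> r \<longrightarrow> v 2 < v 3)) \<and> 3 \<le> r \<and> v 3 \<le> 2 + v 1)"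
      let ?P1 = "(2 \<le> v 1 \<and> (2 \<le> r \<longrightarrow> v 1 < v 2) \<and> (2 \<le> r \<and> v 2 \<le> 1 + v 1) \<and> (3 \<le> r \<longrightarrow> 2 + v 1 \<le> v 3))"
      let ?P2 = "(2 \<le> v 1 \<and> (2 \<le> r \<longrightarrow> v 1 < v 2) \<and> (3 \<le> r \<longrightarrow> 2 \<le> r \<and> v 2 \<le> (v 1 + v 3) / 2)
          \<and> (2 \<le> r \<and> (3 \<le> r \<longrightarrow> v 2 < v 3)) \<and> 3 \<le> r \<and> v 3 < 2 + v 1)"
      let ?P3 = "(0 < v 1 \<and> v 1 < 2 \<and> (2 \<le> r \<longrightarrow> v 1 < v 2) \<and> (2 \<le> r \<and> v 2 \<le> 3 * v 1 / 2) \<and> (3 \<le> r \<longrightarrow> 2 * v 1 \<le> v 3))"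
      let ?P4 = "(0 < v 1 \<and> v 1 < 2 \<and> (2 \<le> r \<longrightarrow> v 1 < v 2) \<and> (3 \<le> r \<longrightarrow> 2 \<le> r \<and> v 2 \<le> (v 1 + v 3) / 2) \<and> 3 \<le> r \<and> v 3 < 2 * v 1)"
      have Q: "of_bool ?Q1 + of_bool ?Q2 = (of_bool (3 \<le> r \<and> m = v 3 - v 1) :: real)"
      proof -
        have eq: "3 \<le> r \<and> m = v 3 - v 1 \<longleftrightarrow> ?Q1 \<or> ?Q2"
          unfolding halves using m_le m_cases v1 v1_pos v2 v3 v23 by (smt (verit))
        have disj: "\<not> (?Q1 \<and> ?Q2)" by auto
        show ?thesis unfolding of_bool_add_disjoint[OF disj] eq ..
      qed
      have P: "of_bool ?P1 + of_bool ?P2 + of_bool ?P3 + of_bool ?P4 = (of_bool (gamma3 r v = v 2 - v 1) :: real)"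
      proof -
        have eq: "gamma3 r v = v 2 - v 1 \<longleftrightarrow> ?P1 \<or> ?P2 \<or> ?P3 \<or> ?P4"
          unfolding halves using m_le m_cases v1 v1_pos v2 v3 v23 m_def by (smt (verit))
        have disj: "\<not> (?P1 \<and> ?P2)" "\<not> ((?P1 \<or> ?P2) \<and> ?P3)" "\<not> (((?P1 \<or> ?P2) \<or> ?P3) \<and> ?P4)" by auto
        show ?thesis
          unfolding of_bool_add_disjoint[OF disj(1)] of_bool_add_disjoint[OF disj(2)]
            of_bool_add_disjoint[OF disj(3)] eq by (simp only: disj_assoc)
      qed
      have sq: "(k3 v \<beta> p x)\<^sup>2 = (A3 v \<beta> p)\<^sup>2 * x powr (- 2 * v 2)"
        by (simp add: k3_def power_mult_distrib power2_eq_square flip: powr_add)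
      show ?thesis
        unfolding coeff_at_powr omega3_def omega_real_conditions P Q
        by (simp only: conds z sq) (simp add: algebra_simps)
    qed
  qed (use x m_gt m_le m_cases v1_pos v2 v3 v23 v1 m_def in auto)
qed

text \<open>
  At $v_1 = 2$ the logarithm and the tail correction have the same order, and the terms
  $2 \kappa A_1$ and $\frac43 \kappa^2$ have the order of $A_2$.
\<close>

lemma limit_logarithm_and_tail_correction:
  assumes x: "x > 0" and v1: "v 1 = 2" and v2: "2 \<le> r \<Longrightarrow> 4 < v 2"
  shows "(\<lambda>n. a n powr gamma4 r v * (a n powr 2 * (F (a n * x) ^ n - Frechet 2 x)
      - k4 v \<beta> p x * Frechet 2 x)) \<longlonglongrightarrow> omega4 r v \<beta> p x * Frechet 2 x"
proof -
  define m where "m = 2 + gamma4 r v"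
  have m_le: "m \<le> 4" "2 \<le> r \<Longrightarrow> m \<le> v 2 - 2"
    and m_cases: "m = 4 \<or> 2 \<le> r \<and> m = v 2 - 2"
    by (auto simp: m_def gamma4_eq)
  have v23: "3 \<le> r \<Longrightarrow> v 2 < v 3" using v_less[of 2 3] by auto
  have m_gt: "m > 2" using m_cases v1 v1_pos v2 v23 by auto
  have "(\<lambda>n. a n powr gamma4 r v * (a n powr (2) * (F (a n * x) ^ n - Frechet (v 1) x)
      - k4 v \<beta> p x * Frechet (v 1) x)) \<longlonglongrightarrow> omega4 r v \<beta> p x * Frechet (v 1) x"
  proof (rule second_order_limit[where m = m])
    show "\<forall>(c, e)\<in>set log_dev_terms. e = 2 \<or> e \<ge> m"
      using m_le v1 v1_pos v2 v23 by (auto simp: log_dev_terms_def tail_dev_terms_def)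
    show "k4 v \<beta> p x = - coeff_at log_dev_terms 2 * x powr (- v 1 - 2)"
    proof -
      have z: "(2::real) \<noteq> 4" "\<not> (2 \<le> r \<and> 2 = v 2 - v 1)"
        "\<not> (2 \<le> r \<and> 2 = v 2 - v 1 + 2)"
        "\<not> (3 \<le> r \<and> 2 = v 3 - v 1)" "(2 = v 1) = True" "2 \<noteq> v 1 + 2"
        "2 \<noteq> 2 * v 1" "\<not> (2 \<le> r \<and> 2 = v 2)"
        using v1 v1_pos v2 v23 by auto
      show ?thesis unfolding mult_minus_left coeff_at_powr k4_def by (simp only: z) (simp add: kappa_2[OF v1] v1 del: One_nat_def)
    qed
    have conds: "2 \<le> r \<and> m = v 2 - v 1 \<longleftrightarrow> (2 \<le> r \<longrightarrow> 4 < v 2) \<and> 2 \<le> r \<and> v 2 \<le> 6"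
        "m = 4 \<longleftrightarrow> (2 \<le> r \<longrightarrow> 6 \<le> v 2)"
        "m = v 1 + 2 \<longleftrightarrow> (2 \<le> r \<longrightarrow> 6 \<le> v 2)"
        "m = 2 * v 1 \<longleftrightarrow> (2 \<le> r \<longrightarrow> 6 \<le> v 2)"
        "gamma4 r v = 2 \<longleftrightarrow> (2 \<le> r \<longrightarrow> 6 \<le> v 2)"
      using m_le m_cases m_gt v1 v1_pos v2 v23 m_def by (smt (verit))+
    have z: "m \<noteq> 2" "m \<noteq> v 1" "\<not> (2 \<le> r \<and> m = v 2 - v 1 + 2)"
        "\<not> (3 \<le> r \<and> m = v 3 - v 1)" "\<not> (2 \<le> r \<and> m = v 2)"
      using m_le m_gt v1 v1_pos v2 v23 by auto
    show "omega4 r v \<beta> p x = of_bool (gamma4 r v = 2) * (k4 v \<beta> p x)\<^sup>2 / 2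
      - coeff_at log_dev_terms m * x powr (- v 1 - m)"
      unfolding coeff_at_powr omega4_def omega_real_conditions conds
      by (simp only: conds z) (simp add: algebra_simps kappa_2[OF v1] v1 power_mult_distrib power_divide del: One_nat_def)
  qed (use x m_gt m_le m_cases v1_pos v2 v23 v1 m_def in auto)
  thus ?thesis by (simp add: v1 del: One_nat_def)
qed

text \<open>
  At $v_2 = v_1 + 2$ the second component joins the tail correction, and its own correction
  $A_4$ has the same order as $A_2$.
\<close>

lemma limit_tail_correction_and_second_component:
  assumes x: "x > 0" and v1: "v 1 > 2" and v2: "2 \<le> r" and v3: "v 2 = v 1 + 2"
  shows "(\<lambda>n. a n powr gamma5 r v * (a n powr 2 * (F (a n * x) ^ n - Frechet (v 1) x)
      - k5 v \<beta> p x * Frechet (v 1) x)) \<longlonglongrightarrow> omega5 r v \<beta> p x * Frechet (v 1) x"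
proof -
  define m where "m = 2 + gamma5 r v"
  have m_le: "m \<le> 4" "m \<le> v 1" "3 \<le> r \<Longrightarrow> m \<le> v 3 - v 1"
    and m_cases: "m = 4 \<or> m = v 1 \<or> 3 \<le> r \<and> m = v 3 - v 1"
    by (auto simp: m_def gamma5_eq)
  have v23: "3 \<le> r \<Longrightarrow> v 2 < v 3" using v_less[of 2 3] by auto
  have m_gt: "m > 2" using m_cases v1 v1_pos v2 v23 v3 by auto
  show ?thesis
  proof (rule second_order_limit[where m = m])
    show "\<forall>(c, e)\<in>set log_dev_terms. e = 2 \<or> e \<ge> m"
      using m_le v1 v1_pos v2 v3 v23 by (auto simp: log_dev_terms_def tail_dev_terms_def)
    show "k5 v \<beta> p x = - coeff_at log_dev_terms 2 * x powr (- v 1 - 2)"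
    proof -
      have z: "(2::real) \<noteq> 4" "(2 \<le> r \<and> 2 = v 2 - v 1) = True"
        "\<not> (2 \<le> r \<and> 2 = v 2 - v 1 + 2)"
        "\<not> (3 \<le> r \<and> 2 = v 3 - v 1)" "2 \<noteq> v 1" "2 \<noteq> v 1 + 2"
        "2 \<noteq> 2 * v 1" "\<not> (2 \<le> r \<and> 2 = v 2)"
        using v1 v1_pos v2 v3 v23 by auto
      show ?thesis unfolding mult_minus_left coeff_at_powr k5_def by (simp only: z) simp
    qed
    have conds: "m = v 1 \<longleftrightarrow> 2 < v 1 \<and> v 1 \<le> 4 \<and> (3 \<le> r \<longrightarrow> 2 * v 1 \<le> v 3)"
        "m = 4 \<longleftrightarrow> 4 \<le> v 1 \<and> (3 \<le> r \<longrightarrow> v 1 + 4 \<le> v 3)"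
        "2 \<le> r \<and> m = v 2 - v 1 + 2 \<longleftrightarrow> 4 \<le> v 1 \<and> (3 \<le> r \<longrightarrow> v 1 + 4 \<le> v 3)"
        "gamma5 r v = 2 \<longleftrightarrow> 4 \<le> v 1 \<and> (3 \<le> r \<longrightarrow> v 1 + 4 \<le> v 3)"
        "3 \<le> r \<and> m = v 3 - v 1 \<longleftrightarrow> (2 < v 1 \<and> v 1 < 4 \<and> (3 \<le> r \<longrightarrow> v 1 + 2 < v 3) \<and> 3 \<le> r \<and> v 3 \<le> 2 * v 1)
        \<or> (4 \<le> v 1 \<and> (3 \<le> r \<longrightarrow> v 1 + 2 < v 3) \<and> 3 \<le> r \<and> v 3 \<le> v 1 + 4)"
      using m_le m_cases m_gt v1 v1_pos v2 v3 v23 m_def by (smt (verit))+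
    have z: "m \<noteq> 2" "\<not> (2 \<le> r \<and> m = v 2 - v 1)" "m \<noteq> v 1 + 2"
        "m \<noteq> 2 * v 1" "\<not> (2 \<le> r \<and> m = v 2)"
      using m_le m_gt v1 v1_pos v2 v3 v23 by auto
    show "omega5 r v \<beta> p x = of_bool (gamma5 r v = 2) * (k5 v \<beta> p x)\<^sup>2 / 2
      - coeff_at log_dev_terms m * x powr (- v 1 - m)"
      unfolding coeff_at_powr omega5_def omega_real_conditions conds
      by (subst of_bool_add_disjoint, (auto)[1], simp only: conds z, simp add: algebra_simps v3)
  qed (use x m_gt m_le m_cases v1_pos v2 v3 v23 v1 m_def in auto)
qed

text \<open>
  At $v_2 = 2 v_1$ the second component has the order of the logarithm, and the product
  $2 \kappa A_3$ that of $\frac43 \kappa^2$.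
\<close>

lemma limit_logarithm_and_second_component:
  assumes x: "x > 0" and v1: "v 1 < 2" and v2: "2 \<le> r" and v3: "v 2 = 2 * v 1"
  shows "(\<lambda>n. a n powr gamma6 r v * (a n powr (v 1) * (F (a n * x) ^ n - Frechet (v 1) x)
      - k6 v \<beta> p x * Frechet (v 1) x)) \<longlonglongrightarrow> omega6 r v \<beta> p x * Frechet (v 1) x"
proof -
  define m where "m = v 1 + gamma6 r v"
  have m_le: "m \<le> 2" "m \<le> 2 * v 1" "3 \<le> r \<Longrightarrow> m \<le> v 3 - v 1"
    and m_cases: "m = 2 \<or> m = 2 * v 1 \<or> 3 \<le> r \<and> m = v 3 - v 1"
    by (auto simp: m_def gamma6_eq)
  have v23: "3 \<le> r \<Longrightarrow> v 2 < v 3" using v_less[of 2 3] by auto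
  have m_gt: "m > v 1" using m_cases v1 v1_pos v2 v23 v3 by auto
  show ?thesis
  proof (rule second_order_limit[where m = m])
    show "\<forall>(c, e)\<in>set log_dev_terms. e = v 1 \<or> e \<ge> m"
      using m_le v1 v1_pos v2 v3 v23 by (auto simp: log_dev_terms_def tail_dev_terms_def)
    show "k6 v \<beta> p x = - coeff_at log_dev_terms (v 1) * x powr (- v 1 - v 1)"
    proof -
      have z: "v 1 \<noteq> 2" "v 1 \<noteq> 4" "(2 \<le> r \<and> v 1 = v 2 - v 1) = True"
        "\<not> (2 \<le> r \<and> v 1 = v 2 - v 1 + 2)"
        "\<not> (3 \<le> r \<and> v 1 = v 3 - v 1)" "v 1 \<noteq> v 1 + 2"
        "v 1 \<noteq> 2 * v 1" "\<not> (2 \<le> r \<and> v 1 = v 2)"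
        using v1 v1_pos v2 v3 v23 by auto
      show ?thesis unfolding mult_minus_left coeff_at_powr k6_def by (simp only: z) (simp add: v3)
    qed
    have conds: "m = 2 \<longleftrightarrow> 1 \<le> v 1 \<and> v 1 < 2 \<and> (3 \<le> r \<longrightarrow> v 1 + 2 \<le> v 3)"
        "m = 2 * v 1 \<longleftrightarrow> 0 < v 1 \<and> v 1 \<le> 1 \<and> (3 \<le> r \<longrightarrow> 3 * v 1 \<le> v 3)"
        "2 \<le> r \<and> m = v 2 \<longleftrightarrow> 0 < v 1 \<and> v 1 \<le> 1 \<and> (3 \<le> r \<longrightarrow> 3 * v 1 \<le> v 3)"
        "gamma6 r v = v 1 \<longleftrightarrow> 0 < v 1 \<and> v 1 \<le> 1 \<and> (3 \<le> r \<longrightarrow> 3 * v 1 \<le> v 3)"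
        "3 \<le> r \<and> m = v 3 - v 1 \<longleftrightarrow> (0 < v 1 \<and> v 1 < 1 \<and> (3 \<le> r \<longrightarrow> 2 * v 1 < v 3) \<and> 3 \<le> r \<and> v 3 \<le> 3 * v 1)
        \<or> (1 \<le> v 1 \<and> v 1 < 2 \<and> (3 \<le> r \<longrightarrow> 2 * v 1 < v 3) \<and> 3 \<le> r \<and> v 3 \<le> v 1 + 2)"
      using m_le m_cases m_gt v1 v1_pos v2 v3 v23 m_def by (smt (verit))+
    have z: "m \<noteq> 4" "m \<noteq> v 1" "\<not> (2 \<le> r \<and> m = v 2 - v 1)"
        "\<not> (2 \<le> r \<and> m = v 2 - v 1 + 2)" "m \<noteq> v 1 + 2"
      using m_le m_gt v1 v1_pos v2 v3 v23 by auto
    show "omega6 r v \<beta> p x = of_bool (gamma6 r v = v 1) * (k6 v \<beta> p x)\<^sup>2 / 2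
      - coeff_at log_dev_terms m * x powr (- v 1 - m)"
      unfolding coeff_at_powr omega6_def omega_real_conditions conds
      by (subst of_bool_add_disjoint, (auto)[1], simp only: conds z, simp add: algebra_simps)
  qed (use x m_gt m_le m_cases v1_pos v2 v3 v23 v1 m_def in auto)
qed

text \<open>
  At $v_1 = 2$, $v_2 = 4$ the three smallest exponents coincide, and all second-order products
  have exponent $4$.
\<close>

lemma limit_all_sources:
  assumes x: "x > 0" and v1: "v 1 = 2" and v2: "2 \<le> r" and v3: "v 2 = 4"
  shows "(\<lambda>n. a n powr gamma7 r v * (a n powr 2 * (F (a n * x) ^ n - Frechet 2 x)
      - k7 v \<beta> p x * Frechet 2 x)) \<longlonglongrightarrow> omega7 r v \<beta> p x * Frechet 2 x"
proof -
  define m where "m = 2 + gamma7 r v"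
  have m_le: "m \<le> 4" "3 \<le> r \<Longrightarrow> m \<le> v 3 - 2"
    and m_cases: "m = 4 \<or> 3 \<le> r \<and> m = v 3 - 2"
    by (auto simp: m_def gamma7_eq)
  have v23: "3 \<le> r \<Longrightarrow> v 2 < v 3" using v_less[of 2 3] by auto
  have m_gt: "m > 2" using m_cases v1 v1_pos v2 v23 v3 by auto
  have "(\<lambda>n. a n powr gamma7 r v * (a n powr (2) * (F (a n * x) ^ n - Frechet (v 1) x)
      - k7 v \<beta> p x * Frechet (v 1) x)) \<longlonglongrightarrow> omega7 r v \<beta> p x * Frechet (v 1) x"
  proof (rule second_order_limit[where m = m])
    show "\<forall>(c, e)\<in>set log_dev_terms. e = 2 \<or> e \<ge> m"
      using m_le v1 v1_pos v2 v3 v23 by (auto simp: log_dev_terms_def tail_dev_terms_def)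
    show "k7 v \<beta> p x = - coeff_at log_dev_terms 2 * x powr (- v 1 - 2)"
    proof -
      have z: "(2::real) \<noteq> 4" "(2 \<le> r \<and> 2 = v 2 - v 1) = True"
        "\<not> (2 \<le> r \<and> 2 = v 2 - v 1 + 2)"
        "\<not> (3 \<le> r \<and> 2 = v 3 - v 1)" "(2 = v 1) = True" "2 \<noteq> v 1 + 2"
        "2 \<noteq> 2 * v 1" "\<not> (2 \<le> r \<and> 2 = v 2)"
        using v1 v1_pos v2 v3 v23 by auto
      show ?thesis unfolding mult_minus_left coeff_at_powr k7_def by (simp only: z) (simp add: kappa_2[OF v1] v1 v3 del: One_nat_def)
    qed
    have conds: "3 \<le> r \<and> m = v 3 - v 1 \<longleftrightarrow> (3 \<le> r \<longrightarrow> 4 < v 3) \<and> 3 \<le> r \<and> v 3 \<le> 6"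
        "m = 4 \<longleftrightarrow> (3 \<le> r \<longrightarrow> 6 \<le> v 3)"
        "m = v 1 + 2 \<longleftrightarrow> (3 \<le> r \<longrightarrow> 6 \<le> v 3)"
        "m = 2 * v 1 \<longleftrightarrow> (3 \<le> r \<longrightarrow> 6 \<le> v 3)"
        "gamma7 r v = 2 \<longleftrightarrow> (3 \<le> r \<longrightarrow> 6 \<le> v 3)"
        "2 \<le> r \<and> m = v 2 - v 1 + 2 \<longleftrightarrow> (3 \<le> r \<longrightarrow> 6 \<le> v 3)"
        "2 \<le> r \<and> m = v 2 \<longleftrightarrow> (3 \<le> r \<longrightarrow> 6 \<le> v 3)"
      using m_le m_cases m_gt v1 v1_pos v2 v3 v23 m_def by (smt (verit))+
    have z: "m \<noteq> 2" "m \<noteq> v 1" "\<not> (2 \<le> r \<and> m = v 2 - v 1)"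
      using m_le m_gt v1 v1_pos v2 v3 v23 by auto
    show "omega7 r v \<beta> p x = of_bool (gamma7 r v = 2) * (k7 v \<beta> p x)\<^sup>2 / 2
      - coeff_at log_dev_terms m * x powr (- v 1 - m)"
      unfolding coeff_at_powr omega7_def omega_real_conditions conds
      by (simp only: conds z) (simp add: algebra_simps kappa_2[OF v1] v1 v3 power_mult_distrib power_divide del: One_nat_def)
  qed (use x m_gt m_le m_cases v1_pos v2 v3 v23 v1 m_def in auto)
  thus ?thesis by (simp add: v1 del: One_nat_def)
qed

end

theorem theorem3p1:
  fixes r :: nat and v \<beta> p :: "nat \<Rightarrow> real" and F :: "real \<Rightarrow> real" and a :: "nat \<Rightarrow> real"
    and x :: real
  assumes "r \<ge> 1"
    and "0 < v 1"
    and "strict_mono_on {1..r} v"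
    and "\<forall>i\<in>{1..r}. p i > 0"
    and "(\<Sum>i = 1..r. p i) = 1"
    and "F = mstd_cdf r v \<beta> p"
    and "a = norming v \<beta> p"
    and "x > 0"
  shows "(0 < v 1 \<and> v 1 < 2 \<and> dof r v 2 > 2 * v 1 \<longrightarrow>
      (\<lambda>n. a n powr gamma1 r v *
        (a n powr v 1 * (F (a n * x) ^ n - Frechet (v 1) x) - k1 v \<beta> p x * Frechet (v 1) x))
      \<longlonglongrightarrow> omega1 r v \<beta> p x * Frechet (v 1) x) \<and>
    (v 1 > 2 \<and> dof r v 2 > v 1 + 2 \<longrightarrow>
      (\<lambda>n. a n powr gamma2 r v *
        (a n powr 2 * (F (a n * x) ^ n - Frechet (v 1) x) - k2 v \<beta> p x * Frechet (v 1) x))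
      \<longlonglongrightarrow> omega2 r v \<beta> p x * Frechet (v 1) x) \<and>
    (0 < v 1 \<and> v 1 < dof r v 2 \<and> dof r v 2 < min (2 * v 1) (v 1 + 2) \<longrightarrow>
      (\<lambda>n. a n powr gamma3 r v *
        (a n powr (v 2 - v 1) * (F (a n * x) ^ n - Frechet (v 1) x) - k3 v \<beta> p x * Frechet (v 1) x))
      \<longlonglongrightarrow> omega3 r v \<beta> p x * Frechet (v 1) x) \<and>
    (v 1 = 2 \<and> dof r v 2 > 4 \<longrightarrow>
      (\<lambda>n. a n powr gamma4 r v *
        (a n powr 2 * (F (a n * x) ^ n - Frechet 2 x) - k4 v \<beta> p x * Frechet 2 x))
      \<longlonglongrightarrow> omega4 r v \<beta> p x * Frechet 2 x) \<and>
    (v 1 > 2 \<and> dof r v 2 = v 1 + 2 \<longrightarrow>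
      (\<lambda>n. a n powr gamma5 r v *
        (a n powr 2 * (F (a n * x) ^ n - Frechet (v 1) x) - k5 v \<beta> p x * Frechet (v 1) x))
      \<longlonglongrightarrow> omega5 r v \<beta> p x * Frechet (v 1) x) \<and>
    (0 < v 1 \<and> v 1 < 2 \<and> dof r v 2 = 2 * v 1 \<longrightarrow>
      (\<lambda>n. a n powr gamma6 r v *
        (a n powr v 1 * (F (a n * x) ^ n - Frechet (v 1) x) - k6 v \<beta> p x * Frechet (v 1) x))
      \<longlonglongrightarrow> omega6 r v \<beta> p x * Frechet (v 1) x) \<and>
    (v 1 = 2 \<and> dof r v 2 = 4 \<longrightarrow>
      (\<lambda>n. a n powr gamma7 r v *
        (a n powr 2 * (F (a n * x) ^ n - Frechet 2 x) - k7 v \<beta> p x * Frechet 2 x))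
      \<longlonglongrightarrow> omega7 r v \<beta> p x * Frechet 2 x)"
proof -
  interpret skew_t_mixture r v \<beta> p
    using assms by unfold_locales
  show ?thesis
    unfolding assms(6,7)
    using limit_logarithm limit_tail_correction limit_second_component
      limit_logarithm_and_tail_correction limit_tail_correction_and_second_component
      limit_logarithm_and_second_component limit_all_sources assms(8)
    by (simp only: omega_real_conditions min_less_iff_conj) blast
qed

end
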